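(* Let $V$ and $V'$ be finite-dimensional JB*-triples of equal rank with open unit balls $D$ and $D'$ respectively, and let $\phi\colon D\to D'$ be a Carathéodory distance-preserving map between these two bounded symmetric domains. If $\phi$ is holomorphic and $\phi(0)=0$, then $\phi$ is the restriction to the unit ball $D$ of a triple homomorphism $V\to V'$.
   Context: A JB*-triple is a complex Banach space $V$ with a triple product $\{\cdot,\cdot,\cdot\}\colon V^3\to V$ such that, for $a,b,x,y,z\in V$: (i) it is linear and symmetric in the outer variables and conjugate linear in the middle variable; (ii) $\{a,b,\{x,y,z\}\}=\{\{a,b,x\},y,z\}-\{x,\{b,a,y\},z\}+\{x,y,\{a,b,z\}\}$; (iii) the operator $a\mathbin{\square}a:=\{a,a,\cdot\}$ is Hermitian with non-negative spectrum; (iv) $\|a\mathbin{\square}a\|=\|a\|^2$. Every finite-dimensional bounded symmetric domain can be realised as the open unit ball of a finite-dimensional JB*-triple, and conversely every such ball is a bounded symmetric domain. A tripotent is an element $e$ with $\{e,e,e\}=e$; elements $a,b$ are orthogonal if $\{a,b,\cdot\}=0$. The rank of $V$ (and of $D$) is the maximum number of mutually orthogonal non-zero tripotents in $V$. A triple homomorphism between JB*-triples is a complex-linear map $T$ that preserves the triple product, i.e. $T\{x,y,z\}=\{Tx,Ty,Tz\}$. The Carathéodory distance on a domain $\Omega$ is $d(x,y)=\sup\{\omega(f(x),f(y)) : f\colon\Omega\to\mathbb{D}\text{ holomorphic}\}$, where $\mathbb{D}$ is the open unit disc in $\mathbb{C}$ and $\omega(z,w)=\tanh^{-1}\left|\frac{z-w}{1-z\overline{w}}\right|$.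 A map between domains is Carathéodory distance-preserving if it preserves the Carathéodory distances of all pairs of points (no surjectivity is assumed). *)

theory Defs
  imports "HOL-Analysis.Analysis" "HOL-Library.Extended_Nat"
begin

section \<open>Complex Banach spaces\<close>

class scaleC = scaleR +
  fixes scaleC :: "complex \<Rightarrow> 'a \<Rightarrow> 'a" (infixr "*\<^sub>C" 75)
  assumes scaleR_scaleC: "scaleR r x = scaleC (complex_of_real r) x"

class complex_vector = scaleC + ab_group_add +
  assumes scaleC_add_right: "a *\<^sub>C (x + y) = a *\<^sub>C x + a *\<^sub>C y"
    and scaleC_add_left: "(a + b) *\<^sub>C x = a *\<^sub>C x + b *\<^sub>C x"
    and scaleC_scaleC: "a *\<^sub>C (b *\<^sub>C x) = (a * b) *\<^sub>C x"
    and scaleC_one: "1 *\<^sub>C x = x"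

class complex_normed_vector = complex_vector + real_normed_vector +
  assumes norm_scaleC: "norm (a *\<^sub>C x) = cmod a * norm x"

class complex_banach = complex_normed_vector + banach

definition complex_finite_dim :: "'a::complex_vector itself \<Rightarrow> bool"
  where "complex_finite_dim _ \<longleftrightarrow> (\<exists>B :: 'a set. finite B \<and> module.span (*\<^sub>C) B = UNIV)"

instantiation complex :: complex_banach
begin

definition scaleC_complex :: "complex \<Rightarrow> complex \<Rightarrow> complex"
  where "scaleC_complex a x = a * x"

instance
  by standard (simp_all add: scaleC_complex_def scaleR_conv_of_real algebra_simps norm_mult)

end

abbreviation clinear :: "('a::complex_vector \<Rightarrow> 'b::complex_vector) \<Rightarrow> bool"
  where "clinear \<equiv> Vector_Spaces.linear (*\<^sub>C) (*\<^sub>C)"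

definition bounded_clinear :: "('a::complex_normed_vector \<Rightarrow> 'b::complex_normed_vector) \<Rightarrow> bool"
  where "bounded_clinear T \<longleftrightarrow> clinear T \<and> bounded_linear T"

definition spectrum :: "('a::complex_normed_vector \<Rightarrow> 'a) \<Rightarrow> complex set"
  where "spectrum T = {\<mu>. \<nexists>S. bounded_clinear S \<and>
    (\<forall>x. S (T x - \<mu> *\<^sub>C x) = x) \<and> (\<forall>x. T (S x) - \<mu> *\<^sub>C S x = x)}"

definition op_exp :: "('a::complex_normed_vector \<Rightarrow> 'a) \<Rightarrow> 'a \<Rightarrow> 'a"
  where "op_exp T x = (\<Sum>n. (T ^^ n) x /\<^sub>R fact n)"

text \<open>Hermitian in the Banach-space sense: the one-parameter group generated by
  \<open>\<i> T\<close> consists of isometries. Stated pointwise rather than as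
  \<open>\<parallel>exp (\<i> t T)\<parallel> = 1\<close>, which would exclude the zero space.\<close>

definition hermitian_op :: "('a::complex_normed_vector \<Rightarrow> 'a) \<Rightarrow> bool"
  where "hermitian_op T \<longleftrightarrow> bounded_clinear T \<and>
    (\<forall>(t::real) x. norm (op_exp (\<lambda>y. (\<i> * of_real t) *\<^sub>C T y) x) = norm x)"


section \<open>JB*-triples\<close>

locale jb_triple =
  fixes triple :: "'a::complex_banach \<Rightarrow> 'a \<Rightarrow> 'a \<Rightarrow> 'a"
  assumes triple_add_left: "triple (x + x') y z = triple x y z + triple x' y z"
    and triple_scaleC_left: "triple (c *\<^sub>C x) y z = c *\<^sub>C triple x y z"
    and triple_commute: "triple x y z = triple z y x"
    and triple_add_mid: "triple x (y + y') z = triple x y z + triple x y' z"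
    and triple_scaleC_mid: "triple x (c *\<^sub>C y) z = cnj c *\<^sub>C triple x y z"
    and triple_jordan: "triple a b (triple x y z) =
      triple (triple a b x) y z - triple x (triple b a y) z + triple x y (triple a b z)"
    and triple_hermitian: "hermitian_op (triple a a)"
    and triple_spectrum: "\<mu> \<in> spectrum (triple a a) \<Longrightarrow> \<mu> \<in> \<real> \<and> 0 \<le> Re \<mu>"
    and triple_norm: "onorm (triple a a) = (norm a)\<^sup>2"

definition tripotent :: "('a \<Rightarrow> 'a \<Rightarrow> 'a \<Rightarrow> 'a) \<Rightarrow> 'a \<Rightarrow> bool"
  where "tripotent triple e \<longleftrightarrow> triple e e e = e"

definition triple_orthogonal :: "('a \<Rightarrow> 'a \<Rightarrow> 'a \<Rightarrow> 'a::zero) \<Rightarrow> 'a \<Rightarrow> 'a \<Rightarrow> bool"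
  where "triple_orthogonal triple a b \<longleftrightarrow> (\<forall>x. triple a b x = 0)"

text \<open>The supremum is taken in \<^typ>\<open>enat\<close>, so it is either a maximum or \<open>\<infinity>\<close>.\<close>

definition triple_rank :: "('a \<Rightarrow> 'a \<Rightarrow> 'a \<Rightarrow> 'a::zero) \<Rightarrow> enat"
  where "triple_rank triple = (SUP E \<in> {E. finite E \<and>
    (\<forall>e\<in>E. tripotent triple e \<and> e \<noteq> 0) \<and> pairwise (triple_orthogonal triple) E}.
    enat (card E))"

definition triple_hom ::
    "('a \<Rightarrow> 'a \<Rightarrow> 'a \<Rightarrow> 'a) \<Rightarrow> ('b \<Rightarrow> 'b \<Rightarrow> 'b \<Rightarrow> 'b) \<Rightarrow>
      ('a::complex_vector \<Rightarrow> 'b::complex_vector) \<Rightarrow> bool"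
  where "triple_hom triple triple' T \<longleftrightarrow> clinear T \<and>
    (\<forall>x y z. T (triple x y z) = triple' (T x) (T y) (T z))"


section \<open>Holomorphic maps and the Caratheodory distance\<close>

definition holomorphic_map ::
    "('a::complex_normed_vector \<Rightarrow> 'b::complex_normed_vector) \<Rightarrow> 'a set \<Rightarrow> bool"
  where "holomorphic_map f \<Omega> \<longleftrightarrow>
    (\<forall>x\<in>\<Omega>. \<exists>T. bounded_clinear T \<and> (f has_derivative T) (at x within \<Omega>))"

definition poincare_dist :: "complex \<Rightarrow> complex \<Rightarrow> real"
  where "poincare_dist z w = artanh (cmod ((z - w) / (1 - z * cnj w)))"

text \<open>Intended for a domain (open connected set) \<open>\<Omega>\<close>, where the set of values is
  nonempty and bounded above, so that the supremum in \<^typ>\<open>real\<close> is the genuine one.\<close>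

definition caratheodory_dist :: "'a::complex_normed_vector set \<Rightarrow> 'a \<Rightarrow> 'a \<Rightarrow> real"
  where "caratheodory_dist \<Omega> x y =
    (SUP f \<in> {f :: 'a \<Rightarrow> complex. holomorphic_map f \<Omega> \<and> f ` \<Omega> \<subseteq> ball 0 1}.
      poincare_dist (f x) (f y))"

end

theory Submission
  imports Defs "HOL-Complex_Analysis.Complex_Analysis"
    "HOL-Computational_Algebra.Fundamental_Theorem_Algebra"
begin

text \<open>
Let \<open>T\<close> be the derivative of \<open>\<phi>\<close> at the origin. By the Schwarz lemma and a norming functional, the
Caratheodory distance from the centre of a unit ball to \<open>x\<close> is \<open>artanh (norm x)\<close>
(\<open>caratheodory_dist_centre\<close>). Hence \<open>\<phi>\<close> preserves norms, and so does the complex linear map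
\<open>T\<close>. Two claims remain: \<open>\<phi> = T\<close>, and \<open>T\<close> preserves the triple product. It is enough to prove
\<open>\<phi> x = T x\<close> and \<open>T (x\<^sup>3) = (T x)\<^sup>3\<close> for \<open>x\<close> in some non-empty open set, where \<open>x\<^sup>3\<close> is the triple cube:
the first equation propagates by the identity theorem
(\<open>holomorphic_eq_isometry_on_ball\<close>), the second one because the cube is a real polynomial map
that determines the triple product by polarization (\<open>triple_hom_of_cube_on_ball\<close>).

The open set consists of elements with large spectrum. Every element of a finite-dimensional
JB*-triple is a sum \<open>\<Sum>s. s e\<^sub>s\<close> over finitely many \<open>s > 0\<close> with orthogonal tripotents \<open>e\<^sub>s\<close>
(\<open>spectral_decomposition\<close>). If \<open>r\<close> is the common rank, a combination of \<open>r\<close> orthogonal tripotents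
with distinct positive coefficients has \<open>r\<close> spectral values, and by semicontinuity all nearby elements have
at least \<open>r\<close> (\<open>open_set_of_large_spectrum\<close>).

For such an \<open>x = \<Sum>s. s e\<^sub>s\<close>, the geometry of the unit ball controls the images. If a disc centred
at \<open>u + b\<close>, with \<open>u\<close> a tripotent and \<open>b\<close> orthogonal to \<open>u\<close>, lies in the closed unit ball, then its
direction is orthogonal to \<open>u\<close> (\<open>disc_around_tripotent_orthogonal\<close>). The vectors
\<open>T e\<^sub>s + \<mu> T e\<^sub>t\<close> with \<open>s \<noteq> t\<close> and \<open>\<bar>\<mu>\<bar> \<le> 1\<close> have norm at most one. So the spectral tripotents
of the \<open>T e\<^sub>s\<close> for the spectral value \<open>1\<close> are at least \<open>r\<close> mutually orthogonal tripotents in a triple of rank \<open>r\<close>, nothing non-zero is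
orthogonal to all of them, and \<open>T e\<^sub>s\<close> must coincide with its leading spectral tripotent
(\<open>isometry_preserves_frame\<close>). This gives \<open>T (x\<^sup>3) = (T x)\<^sup>3\<close>. It also shows that
\<open>T (\<Sum>s. \<theta>\<^sub>s e\<^sub>s)\<close> is a complex extreme point of the unit ball whenever \<open>\<bar>\<theta>\<^sub>s\<bar> = 1\<close>. At an extreme point
the Schwarz lemma is rigid (\<open>schwarz_equality_at_extreme_point\<close>), so \<open>\<phi> = T\<close> on all tori
\<open>\<rho> \<Sum>s. \<theta>\<^sub>s e\<^sub>s\<close>, and the maximum principle fills in the polydisc that contains \<open>x\<close>
(\<open>holomorphic_eq_isometry_on_frame\<close>).

The structure theory rests on two sources. The Jordan identity yields power associativity
(\<open>odd_pow_box\<close>) and the Peirce decomposition of a tripotent. The Hermitian and spectral conditions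
make the operators \<open>triple a a\<close> diagonalisable with eigenvalues \<open>\<ge> 0\<close>. The isometries that they
generate rotate the Peirce spaces of a tripotent; averages of these rotations, combined with the
value \<open>(norm a)\<^sup>2\<close> for the norm of \<open>triple a a\<close>, give the norm estimates.
\<close>

section \<open>Complex linear maps\<close>

interpretation cvs: vector_space "(*\<^sub>C) :: complex \<Rightarrow> 'a \<Rightarrow> 'a::complex_vector"
  by unfold_locales (simp_all add: scaleC_add_right scaleC_add_left scaleC_scaleC scaleC_one)

lemma clinear_iff:
  "clinear T \<longleftrightarrow> (\<forall>x y. T (x + y) = T x + T y) \<and> (\<forall>c x. T (c *\<^sub>C x) = c *\<^sub>C T x)"
  by (simp add: Vector_Spaces.linear_iff cvs.vector_space_axioms)

lemma clinear_add: "clinear T \<Longrightarrow> T (x + y) = T x + T y"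
  and clinear_scaleC: "clinear T \<Longrightarrow> T (c *\<^sub>C x) = c *\<^sub>C T x"
  by (auto simp: clinear_iff)

lemma clinear_0: "clinear T \<Longrightarrow> T 0 = 0"
  using clinear_scaleC[of T 0 0] by simp

lemma clinear_minus: "clinear T \<Longrightarrow> T (- x) = - T x"
  using clinear_scaleC[of T "-1" x] by simp

lemma clinear_diff: "clinear T \<Longrightarrow> T (x - y) = T x - T y"
  using clinear_add[of T x "- y"] by (simp add: clinear_minus)

lemma clinear_sum: "clinear T \<Longrightarrow> T (sum f A) = (\<Sum>a\<in>A. T (f a))"
  by (induction A rule: infinite_finite_induct) (auto simp: clinear_0 clinear_add)

lemma clinear_funpow:
  fixes T :: "'a::complex_vector \<Rightarrow> 'a"
  shows "clinear T \<Longrightarrow> clinear (T ^^ n)"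
  by (induction n) (auto simp: clinear_iff)

lemmas clinear_simps = clinear_add clinear_scaleC clinear_0 clinear_minus clinear_diff clinear_sum

lemma scaleC_of_real: "of_real r *\<^sub>C x = r *\<^sub>R (x :: 'a::complex_vector)"
  by (simp add: scaleR_scaleC)

lemma scaleC_scaleR_commute: "c *\<^sub>C (r *\<^sub>R x) = r *\<^sub>R (c *\<^sub>C (x :: 'a::complex_vector))"
  by (simp add: scaleR_scaleC mult.commute)

lemma bounded_linear_scaleC_left: "bounded_linear (\<lambda>c. c *\<^sub>C (x :: 'a::complex_normed_vector))"
  by (rule bounded_linear_intro[where K = "norm x"])
     (auto simp: scaleC_add_left norm_scaleC scaleR_scaleC scaleC_complex_def)

lemma bounded_linear_scaleC_right: "bounded_linear (\<lambda>x. c *\<^sub>C (x :: 'a::complex_normed_vector))"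
  by (rule bounded_linear_intro[where K = "cmod c"])
     (auto simp: scaleC_add_right norm_scaleC scaleC_scaleR_commute)

lemma bounded_clinear_imp_clinear: "bounded_clinear T \<Longrightarrow> clinear T"
  and bounded_clinear_imp_bounded_linear: "bounded_clinear T \<Longrightarrow> bounded_linear T"
  by (auto simp: bounded_clinear_def)

section \<open>Exponentials of Hermitian operators\<close>

lemma exp_scaleC_sums:
  "(\<lambda>n. (c ^ n *\<^sub>C x) /\<^sub>R fact n) sums (exp c *\<^sub>C (x :: 'a::complex_normed_vector))"
  using bounded_linear.sums[OF bounded_linear_scaleC_left exp_converges[of c], of x]
  by (simp add: scaleR_scaleC scaleC_complex_def)

text \<open>Differentiating the exponential series termwise in \<open>c\<close> reproduces it up to an index shift. The
differentiated series is the coefficient of the second vector in a Jordan chain.\<close>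

lemma exp_deriv_scaleC_sums:
  "(\<lambda>n. ((of_nat n * c ^ (n - 1)) *\<^sub>C x) /\<^sub>R fact n) sums
    (exp c *\<^sub>C (x :: 'a::complex_normed_vector))"
proof -
  have "((of_nat (Suc n) * c ^ (Suc n - 1)) *\<^sub>C x) /\<^sub>R fact (Suc n) = (c ^ n *\<^sub>C x) /\<^sub>R fact n" for n
  proof -
    have "complex_of_real (inverse (fact (Suc n))) * (of_nat (Suc n) * c ^ n)
        = complex_of_real (inverse (fact n)) * c ^ n"
      by (simp add: field_simps del: of_nat_Suc)
    then show ?thesis by (simp add: scaleR_scaleC del: of_nat_Suc fact_Suc)
  qed
  then show ?thesis
    using exp_scaleC_sums[of c x]
      sums_Suc_iff[of "\<lambda>n. ((of_nat n * c ^ (n - 1)) *\<^sub>C x) /\<^sub>R fact n" "exp c *\<^sub>C x"]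
    by (simp del: of_nat_Suc fact_Suc)
qed

lemma op_exp_sum_eigenvectors:
  fixes T :: "'a::complex_normed_vector \<Rightarrow> 'a"
  assumes T: "clinear T" and ev: "\<And>i. i \<in> I \<Longrightarrow> T (x i) = \<mu> i *\<^sub>C x i"
  shows "op_exp T (\<Sum>i\<in>I. x i) = (\<Sum>i\<in>I. exp (\<mu> i) *\<^sub>C x i)"
proof -
  have 1: "(T ^^ n) (x i) = \<mu> i ^ n *\<^sub>C x i" if "i \<in> I" for n i
    by (induction n) (auto simp: ev that clinear_simps[OF T] mult.commute)
  have "(T ^^ n) (\<Sum>i\<in>I. x i) /\<^sub>R fact n = (\<Sum>i\<in>I. (\<mu> i ^ n *\<^sub>C x i) /\<^sub>R fact n)" for n
    by (simp add: clinear_sum[OF clinear_funpow[OF T]] 1 scaleR_sum_right)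
  moreover have "(\<lambda>n. \<Sum>i\<in>I. (\<mu> i ^ n *\<^sub>C x i) /\<^sub>R fact n) sums (\<Sum>i\<in>I. exp (\<mu> i) *\<^sub>C x i)"
    by (intro sums_sum exp_scaleC_sums)
  ultimately show ?thesis
    unfolding op_exp_def by (simp add: sums_iff)
qed

lemma op_exp_jordan_chain:
  fixes T :: "'a::complex_normed_vector \<Rightarrow> 'a"
  assumes T: "clinear T" and w: "T w = c *\<^sub>C w" and v: "T v = c *\<^sub>C v + w"
  shows "op_exp T v = exp c *\<^sub>C (v + w)"
proof -
  have "(T ^^ n) v = c ^ n *\<^sub>C v + (of_nat n * c ^ (n - 1)) *\<^sub>C w" for n
  proof (induction n)
    case (Suc n)
    then show ?case
      by (cases n) (simp_all add: v w clinear_simps[OF T] scaleC_add_right algebra_simps flip: scaleC_add_left)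
  qed simp
  then have "(\<lambda>n. (T ^^ n) v /\<^sub>R fact n) =
      (\<lambda>n. (c ^ n *\<^sub>C v) /\<^sub>R fact n + ((of_nat n * c ^ (n - 1)) *\<^sub>C w) /\<^sub>R fact n)"
    by (simp add: scaleR_add_right)
  moreover have "\<dots> sums (exp c *\<^sub>C v + exp c *\<^sub>C w)"
    by (intro sums_add exp_scaleC_sums exp_deriv_scaleC_sums)
  ultimately show ?thesis
    unfolding op_exp_def by (simp add: sums_iff scaleC_add_right)
qed

lemma hermitian_op_clinear: "hermitian_op T \<Longrightarrow> clinear T"
  by (simp add: hermitian_op_def bounded_clinear_def)

text \<open>On a Jordan chain, \<open>exp (\<i> t T) v = exp (\<i> t \<mu>) (v + \<i> t w)\<close> grows linearly in \<open>t\<close>, which is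
impossible for a group of isometries. In finite dimension this makes Hermitian operators
diagonalisable.\<close>

lemma hermitian_op_no_jordan_chain:
  assumes T: "hermitian_op T" and mu: "\<mu> \<in> \<real>"
    and w: "T w = \<mu> *\<^sub>C w" and v: "T v = \<mu> *\<^sub>C v + w"
  shows "w = 0"
proof (rule ccontr)
  assume "w \<noteq> 0"
  note lin = hermitian_op_clinear[OF T]
  have eq: "norm (v + (\<i> * of_real t) *\<^sub>C w) = norm v" for t :: real
  proof -
    let ?S = "\<lambda>y. (\<i> * of_real t) *\<^sub>C T y"
    have "clinear ?S"
      using lin by (auto simp: clinear_iff scaleC_add_right mult.commute)
    from op_exp_jordan_chain[OF this, where c = "\<i> * of_real t * \<mu>" and v = v and w = "(\<i> * of_real t) *\<^sub>C w"]
    have "op_exp ?S v = exp (\<i> * of_real t * \<mu>) *\<^sub>C (v + (\<i> * of_real t) *\<^sub>C w)"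
      by (simp add: w v clinear_simps[OF lin] scaleC_add_right algebra_simps)
    moreover have "cmod (exp (\<i> * of_real t * \<mu>)) = 1"
      using mu by (auto simp: complex_is_Real_iff)
    moreover have "norm (op_exp ?S v) = norm v"
      using T by (simp add: hermitian_op_def)
    ultimately show ?thesis by (simp add: norm_scaleC del: norm_exp_eq_Re)
  qed
  define t where "t = (2 * norm v + 1) / norm w"
  have "norm ((\<i> * of_real t) *\<^sub>C w) = \<bar>t\<bar> * norm w"
    by (simp add: norm_scaleC norm_mult)
  then have 1: "norm ((\<i> * of_real t) *\<^sub>C w) = 2 * norm v + 1"
    using \<open>w \<noteq> 0\<close> by (simp add: t_def)
  have "norm ((\<i> * of_real t) *\<^sub>C w) \<le> norm (v + (\<i> * of_real t) *\<^sub>C w) + norm v"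
    by (metis add_diff_cancel_left' norm_triangle_ineq4)
  then show False using 1 eq[of t] by simp
qed

lemma eigenvalue_in_spectrum:
  assumes "T v = \<mu> *\<^sub>C v" "v \<noteq> 0"
  shows "\<mu> \<in> spectrum T"
  unfolding spectrum_def
proof (rule CollectI, rule notI)
  assume "\<exists>S. bounded_clinear S \<and> (\<forall>x. S (T x - \<mu> *\<^sub>C x) = x) \<and> (\<forall>x. T (S x) - \<mu> *\<^sub>C S x = x)"
  then obtain S where S: "bounded_clinear S" "S (T v - \<mu> *\<^sub>C v) = v" by blast
  then show False
    using assms clinear_0[OF bounded_clinear_imp_clinear[OF S(1)]] by simp
qed

section \<open>Eigenvector decompositions in finite dimension\<close>

text \<open>This is \<open>p(T) x\<close>. The fold peels off the constant coefficient, so that all recursion goes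
through the argument \<open>x\<close> and no powers of the operator have to be composed.\<close>

definition op_poly :: "('a::complex_vector \<Rightarrow> 'a) \<Rightarrow> complex poly \<Rightarrow> 'a \<Rightarrow> 'a"
  where "op_poly T p = fold_coeffs (\<lambda>c f x. c *\<^sub>C x + f (T x)) p (\<lambda>_. 0)"

lemma op_poly_0 [simp]: "op_poly T 0 x = 0"
  by (simp add: op_poly_def)

lemma op_poly_pCons [simp]:
  "clinear T \<Longrightarrow> op_poly T (pCons c p) x = c *\<^sub>C x + op_poly T p (T x)"
  by (cases "p = 0 \<and> c = 0") (auto simp: op_poly_def)

lemma op_poly_add:
  assumes "clinear T"
  shows "op_poly T p (x + y) = op_poly T p x + op_poly T p y"
  by (induction p arbitrary: x y) (simp_all add: assms clinear_simps[OF assms] scaleC_add_right)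

lemma op_poly_scaleC:
  assumes "clinear T"
  shows "op_poly T p (c *\<^sub>C x) = c *\<^sub>C op_poly T p x"
  by (induction p arbitrary: x) (simp_all add: assms clinear_simps[OF assms] scaleC_add_right mult.commute)

lemma op_poly_add_left:
  assumes "clinear T"
  shows "op_poly T (p + q) x = op_poly T p x + op_poly T q x"
  by (induction p q arbitrary: x rule: poly_induct2)
     (simp_all add: assms scaleC_add_left)

lemma op_poly_smult:
  assumes "clinear T"
  shows "op_poly T (smult c p) x = c *\<^sub>C op_poly T p x"
  by (induction p arbitrary: x) (simp_all add: assms scaleC_add_right)

lemma op_poly_root_factor:
  assumes "clinear T"
  shows "op_poly T ([:- \<mu>, 1:] * p) x = op_poly T p (T x - \<mu> *\<^sub>C x)"
proof -
  have "op_poly T p (T x - \<mu> *\<^sub>C x) = op_poly T p (T x) + op_poly T p ((- \<mu>) *\<^sub>C x)"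
    using op_poly_add[OF assms, of p "T x" "(- \<mu>) *\<^sub>C x"] by simp
  moreover have "[:- \<mu>, 1:] * p = pCons 0 p + smult (- \<mu>) p" by simp
  ultimately show ?thesis
    by (simp only: op_poly_add_left[OF assms] op_poly_smult[OF assms] op_poly_scaleC[OF assms]
        op_poly_pCons[OF assms]) simp
qed

abbreviation orbit_span :: "('a::complex_vector \<Rightarrow> 'a) \<Rightarrow> 'a \<Rightarrow> 'a set"
  where "orbit_span T x \<equiv> cvs.span (range (\<lambda>n. (T ^^ n) x))"

lemma orbit_span_base: "x \<in> orbit_span T x"
  by (rule cvs.span_base) (auto intro: range_eqI[of _ _ 0])

lemma orbit_span_least:
  assumes W: "cvs.subspace W" and "\<And>y. y \<in> W \<Longrightarrow> T y \<in> W" and "x \<in> W"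
  shows "orbit_span T x \<subseteq> W"
proof (rule cvs.span_minimal[OF _ W])
  have "(T ^^ n) x \<in> W" for n
    by (induction n) (auto simp: assms)
  then show "range (\<lambda>n. (T ^^ n) x) \<subseteq> W" by auto
qed

lemma orbit_span_invariant:
  assumes "clinear T" "y \<in> orbit_span T x"
  shows "T y \<in> orbit_span T x"
  using assms(2)
proof (induction rule: cvs.span_induct_alt)
  case (step c a y)
  then obtain n where "a = (T ^^ n) x" by auto
  then have "T a = (T ^^ Suc n) x" by simp
  then have "T a \<in> orbit_span T x" by (metis cvs.span_base rangeI)
  then show ?case
    by (simp add: clinear_simps[OF assms(1)] cvs.span_add cvs.span_scale step)
qed (simp add: clinear_0[OF assms(1)] cvs.span_zero)

text \<open>Induction on the degree of \<open>p\<close>. Splitting off a root \<open>\<mu>\<close> leaves a polynomial that kills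
\<open>T y - \<mu> y\<close>, so this vector is a sum of eigenvectors. Dividing its component at each
\<open>\<nu> \<noteq> \<mu>\<close> by \<open>\<nu> - \<mu>\<close> gives a sum \<open>z\<close> of eigenvectors for which \<open>T - \<mu>\<close> sends \<open>y - z\<close> into the
\<open>\<mu>\<close>-eigenspace; without Jordan chains, \<open>y - z\<close> is then itself an eigenvector. The invariant
subspace \<open>W\<close> records where the components live.\<close>

lemma eigenvector_decomposition_of_op_poly:
  fixes T :: "'a::complex_vector \<Rightarrow> 'a"
  assumes T: "clinear T"
    and no_chain: "\<And>\<mu> v w. T w = \<mu> *\<^sub>C w \<Longrightarrow> T v = \<mu> *\<^sub>C v + w \<Longrightarrow> w = 0"
    and W: "cvs.subspace W" and inv: "\<And>y. y \<in> W \<Longrightarrow> T y \<in> W"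
    and "p \<noteq> 0" "y \<in> W" "op_poly T p y = 0"
  shows "\<exists>M f. finite M \<and> (\<forall>\<mu>\<in>M. f \<mu> \<in> W \<and> T (f \<mu>) = \<mu> *\<^sub>C f \<mu>) \<and> y = (\<Sum>\<mu>\<in>M. f \<mu>)"
  using assms(5-)
proof (induction "degree p" arbitrary: p y)
  case 0
  then obtain c where "p = [:c:]" "c \<noteq> 0"
    by (metis degree_eq_zeroE pCons_0_0)
  then have "y = 0"
    using 0 T by simp
  then show ?case by (intro exI[of _ "{}"]) auto
next
  case (Suc n)
  have "0 < degree p" using Suc.hyps(2) by simp
  then obtain \<mu> where "poly p \<mu> = 0"
    using alg_closed_imp_poly_has_root[of p] by blast
  then obtain q where q: "p = [:- \<mu>, 1:] * q" by (meson dvdE poly_eq_0_iff_dvd)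
  then have "q \<noteq> 0" using \<open>p \<noteq> 0\<close> by auto
  then have deg: "n = degree q" using Suc(2) unfolding q by (subst (asm) degree_mult_eq) auto
  let ?y = "T y - \<mu> *\<^sub>C y"
  have "op_poly T q ?y = 0"
    using Suc.prems(3) op_poly_root_factor[OF T] q by metis
  moreover have "?y \<in> W"
    using W inv Suc.prems(2) by (simp add: cvs.subspace_diff cvs.subspace_scale)
  ultimately obtain M f where "finite M \<and> (\<forall>\<nu>\<in>M. f \<nu> \<in> W \<and> T (f \<nu>) = \<nu> *\<^sub>C f \<nu>) \<and> ?y = sum f M"
    using Suc.hyps(1)[OF deg \<open>q \<noteq> 0\<close>, of ?y] by metis
  then have M: "finite M" "\<And>\<nu>. \<nu> \<in> M \<Longrightarrow> f \<nu> \<in> W"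
      "\<And>\<nu>. \<nu> \<in> M \<Longrightarrow> T (f \<nu>) = \<nu> *\<^sub>C f \<nu>" "?y = sum f M"
    by auto
  define g where "g \<nu> = (1 / (\<nu> - \<mu>)) *\<^sub>C f \<nu>" for \<nu>
  define z where "z = (\<Sum>\<nu>\<in>M - {\<mu>}. g \<nu>)"
  define w where "w = (if \<mu> \<in> M then f \<mu> else 0)"
  have gW: "g \<nu> \<in> W" "T (g \<nu>) = \<nu> *\<^sub>C g \<nu>" if "\<nu> \<in> M" for \<nu>
    using M that W by (auto simp: g_def cvs.subspace_scale clinear_simps[OF T] mult.commute)
  have "T (g \<nu>) - \<mu> *\<^sub>C g \<nu> = f \<nu>" if "\<nu> \<in> M - {\<mu>}" for \<nu>
  proof -
    have "T (g \<nu>) - \<mu> *\<^sub>C g \<nu> = (\<nu> - \<mu>) *\<^sub>C g \<nu>"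
      using gW that by (simp add: cvs.scale_left_diff_distrib)
    also have "\<dots> = f \<nu>" using that by (simp add: g_def)
    finally show ?thesis .
  qed
  then have "T z - \<mu> *\<^sub>C z = (\<Sum>\<nu>\<in>M - {\<mu>}. f \<nu>)"
    by (simp add: z_def clinear_simps[OF T] cvs.scale_sum_right flip: sum_subtractf)
  then have "?y = w + (T z - \<mu> *\<^sub>C z)"
    using M(1,4) sum.remove[OF M(1), of \<mu> f] by (simp add: w_def)
  then have "T (y - z) = \<mu> *\<^sub>C (y - z) + w"
    by (simp add: clinear_simps[OF T] cvs.scale_right_diff_distrib algebra_simps)
  moreover have "T w = \<mu> *\<^sub>C w" using M by (auto simp: w_def clinear_0[OF T])
  ultimately have eig: "T (y - z) = \<mu> *\<^sub>C (y - z)" using no_chain[of w \<mu> "y - z"] by simp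
  have zW: "z \<in> W" unfolding z_def by (intro cvs.subspace_sum[OF W] gW) auto
  define h where "h \<nu> = (if \<nu> = \<mu> then y - z else g \<nu>)" for \<nu>
  have "sum h (M - {\<mu>}) = z"
    unfolding z_def h_def by (intro sum.cong) auto
  moreover have "sum h (insert \<mu> (M - {\<mu>})) = h \<mu> + sum h (M - {\<mu>})"
    using M(1) by (intro sum.insert) auto
  ultimately have "y = sum h (insert \<mu> (M - {\<mu>}))"
    by (simp add: h_def)
  moreover have "h \<nu> \<in> W \<and> T (h \<nu>) = \<nu> *\<^sub>C h \<nu>" if "\<nu> \<in> insert \<mu> (M - {\<mu>})" for \<nu>
  proof (cases "\<nu> = \<mu>")
    case True
    then show ?thesis
      using eig zW Suc.prems(2) W by (simp add: h_def cvs.subspace_diff)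
  next
    case False
    then show ?thesis using gW[of \<nu>] that by (simp add: h_def)
  qed
  moreover have "finite (insert \<mu> (M - {\<mu>}))" using M(1) by simp
  ultimately show ?case by blast
qed

text \<open>The comparison of an independent set with a spanning set, for indexed families: injectivity of
\<open>F\<close> comes out of the independence instead of being a side condition.\<close>

lemma card_le_of_family_independent:
  fixes F :: "'i \<Rightarrow> 'a::complex_vector"
  assumes A: "finite A" and B: "finite B" and FB: "\<And>a. a \<in> A \<Longrightarrow> F a \<in> cvs.span B"
    and ind: "\<And>d. (\<Sum>a\<in>A. d a *\<^sub>C F a) = 0 \<Longrightarrow> \<forall>a\<in>A. d a = 0"
  shows "card A \<le> card B"
proof -
  have inj: "inj_on F A"
  proof (rule inj_onI, rule ccontr)
    fix a b assume ab: "a \<in> A" "b \<in> A" "F a = F b" "a \<noteq> b"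
    define d :: "'i \<Rightarrow> complex" where "d = (\<lambda>x. if x = a then 1 else if x = b then -1 else 0)"
    have "(\<Sum>x\<in>A. d x *\<^sub>C F x) = (\<Sum>x\<in>{a, b}. d x *\<^sub>C F x)"
      using A ab by (intro sum.mono_neutral_right) (auto simp: d_def)
    also have "\<dots> = 0" using ab by (simp add: d_def)
    finally show False using ind[of d] ab by (auto simp: d_def)
  qed
  have "cvs.independent (F ` A)"
    unfolding cvs.independent_explicit_module
  proof (intro allI impI)
    fix S u v assume S: "finite S" "S \<subseteq> F ` A" "(\<Sum>v\<in>S. u v *\<^sub>C v) = 0" "v \<in> S"
    define d where "d = (\<lambda>a. if F a \<in> S then u (F a) else 0)"
    have "(\<Sum>a\<in>A. d a *\<^sub>C F a) = (\<Sum>v\<in>F ` A. (if v \<in> S then u v else 0) *\<^sub>C v)"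
      by (simp add: sum.reindex[OF inj] d_def)
    also have "\<dots> = (\<Sum>v\<in>S. u v *\<^sub>C v)"
      using S A by (intro sum.mono_neutral_cong_right) auto
    finally have "\<forall>a\<in>A. d a = 0" using S ind by simp
    moreover obtain a where "a \<in> A" "v = F a" using S by auto
    ultimately have "d a = 0" by blast
    then show "u v = 0" using S(4) \<open>v = F a\<close> by (simp add: d_def)
  qed
  then have "card (F ` A) \<le> card B"
    using cvs.independent_span_bound[OF B, of "F ` A"] FB by auto
  then show ?thesis by (simp add: card_image[OF inj])
qed

text \<open>One more iterate \<open>x, T x, T\<^sup>2 x, \<dots>\<close> than the size of a spanning set must satisfy a linear
relation, and its coefficients form the polynomial.\<close>

lemma finite_dim_annihilating_poly:
  fixes T :: "'a::complex_vector \<Rightarrow> 'a"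
  assumes "complex_finite_dim TYPE('a)" "clinear T"
  shows "\<exists>p. p \<noteq> 0 \<and> op_poly T p x = 0"
proof -
  obtain B :: "'a set" where B: "finite B" "cvs.span B = UNIV"
    using assms(1) by (auto simp: complex_finite_dim_def)
  have "\<not> card {..card B} \<le> card B" by simp
  then obtain d where d: "(\<Sum>i\<in>{..card B}. d i *\<^sub>C (T ^^ i) x) = 0" "\<not> (\<forall>i\<in>{..card B}. d i = 0)"
    using card_le_of_family_independent[of "{..card B}" B "\<lambda>i. (T ^^ i) x"] B by auto
  define p where "p = (\<Sum>i\<le>card B. monom (d i) i)"
  have c: "coeff p i = (if i \<le> card B then d i else 0)" for i
    by (simp add: p_def coeff_sum)
  have "op_poly T (monom (d i) i) y = d i *\<^sub>C (T ^^ i) y" for i y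
  proof (induction i arbitrary: y)
    case (Suc i)
    have "op_poly T (monom c i) y = c *\<^sub>C (T ^^ i) y" for c y
      by (induction i arbitrary: y) (simp_all add: monom_Suc monom_0 assms funpow_swap1)
    then show ?case by (simp add: monom_Suc assms funpow_swap1)
  qed (simp add: monom_0 assms)
  moreover have "op_poly T (sum f A) x = (\<Sum>i\<in>A. op_poly T (f i) x)" for f :: "nat \<Rightarrow> complex poly" and A
    by (induction A rule: infinite_finite_induct) (auto simp: op_poly_add_left assms)
  ultimately have "op_poly T p x = 0" using d(1) by (simp add: p_def)
  moreover have "p \<noteq> 0" using d(2) c by (auto simp: poly_eq_iff)
  ultimately show ?thesis by blast
qed

text \<open>Applying \<open>T - \<mu> k\<close> to the sum removes the component at \<open>k\<close> and only rescales the others.\<close>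

lemma invariant_subspace_contains_eigen_components:
  fixes T :: "'a::complex_vector \<Rightarrow> 'a"
  assumes T: "clinear T" and W: "cvs.subspace W" and inv: "\<And>y. y \<in> W \<Longrightarrow> T y \<in> W"
    and "finite J" and inj: "inj_on \<mu> J"
    and ev: "\<And>j. j \<in> J \<Longrightarrow> T (v j) = \<mu> j *\<^sub>C v j"
    and "(\<Sum>j\<in>J. v j) \<in> W"
  shows "\<forall>j\<in>J. v j \<in> W"
  using assms(4-)
proof (induction J arbitrary: v rule: finite_induct)
  case (insert k J)
  let ?y = "\<Sum>j\<in>insert k J. v j"
  have "T ?y - \<mu> k *\<^sub>C ?y = (\<Sum>j\<in>J. (\<mu> j - \<mu> k) *\<^sub>C v j)"
    using insert.prems(2) insert.hyps
    by (simp add: clinear_simps[OF T] scaleC_add_right cvs.scale_sum_right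
        cvs.scale_left_diff_distrib sum_subtractf)
  moreover have "T ?y - \<mu> k *\<^sub>C ?y \<in> W"
    using insert.prems(3) inv W by (simp add: cvs.subspace_diff cvs.subspace_scale del: sum.insert)
  ultimately have "(\<Sum>j\<in>J. (\<mu> j - \<mu> k) *\<^sub>C v j) \<in> W" by simp
  then have "\<forall>j\<in>J. (\<mu> j - \<mu> k) *\<^sub>C v j \<in> W"
    using insert.prems by (intro insert.IH) (auto simp: clinear_simps[OF T] mult.commute inj_on_def)
  then have J: "\<forall>j\<in>J. v j \<in> W"
  proof safe
    fix j assume j: "j \<in> J" "\<forall>j\<in>J. (\<mu> j - \<mu> k) *\<^sub>C v j \<in> W"
    then have "\<mu> j \<noteq> \<mu> k" using insert by (auto simp: inj_on_def)
    moreover have "(1 / (\<mu> j - \<mu> k)) *\<^sub>C ((\<mu> j - \<mu> k) *\<^sub>C v j) \<in> W"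
      using j W cvs.subspace_scale by blast
    ultimately show "v j \<in> W" by simp
  qed
  then have "(\<Sum>j\<in>J. v j) \<in> W" using W by (intro cvs.subspace_sum) auto
  then have "?y - (\<Sum>j\<in>J. v j) \<in> W" using insert.prems(3) W cvs.subspace_diff by blast
  then show ?case using J insert.hyps by simp
qed auto

section \<open>Odd powers in a JB*-triple\<close>

text \<open>The two hypotheses are point reflections of the sequence, about different centres. Composing
them gives a translation by two steps, so the sequence is an arithmetic progression
\<open>E p = E 0 + p \<eta>\<close>; comparing both ends then yields \<open>(n + 2) \<eta> = 0\<close>.\<close>

lemma arithmetic_progression_of_reflections:
  fixes E :: "nat \<Rightarrow> 'a::real_vector"
  assumes r0: "\<And>j. j \<le> n \<Longrightarrow> E (j + 1) + E (n + 1 - j) = 2 *\<^sub>R E 0"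
    and r1: "\<And>i. i \<le> n \<Longrightarrow> E i + E (n - i) = 2 *\<^sub>R E (n + 1)"
    and p: "p \<le> n + 1"
  shows "E p = E 0"
proof -
  define \<eta> where "\<eta> = E 0 - E (n + 1)"
  have AP: "p \<le> n + 1 \<Longrightarrow> E p = E 0 + real p *\<^sub>R \<eta>" for p
  proof (induction p rule: less_induct)
    case (less p)
    consider "p = 0" | "p = 1" | m where "p = m + 2"
      by (metis One_nat_def add_2_eq_Suc' not0_implies_Suc)
    then show ?case
    proof cases
      case 2
      then show ?thesis using r0[of 0] by (simp add: \<eta>_def scaleR_2 algebra_simps)
    next
      case 3
      have "E (m + 2) + E (n - m) = 2 *\<^sub>R E 0" using r0[of "m + 1"] 3 less.prems by simp
      moreover have "E m + E (n - m) = 2 *\<^sub>R E (n + 1)" using r1[of m] 3 less.prems by simp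
      moreover have "E (m + 2) - E m = (E (m + 2) + E (n - m)) - (E m + E (n - m))" by simp
      ultimately have "E (m + 2) - E m = 2 *\<^sub>R \<eta>" by (simp only: \<eta>_def scaleR_diff_right)
      then have "E (m + 2) = E m + 2 *\<^sub>R \<eta>" by (simp add: algebra_simps)
      then show ?thesis using less.IH[of m] 3 less.prems by (simp add: algebra_simps)
    qed simp
  qed
  have "E 0 + real (n + 1) *\<^sub>R \<eta> = E 0 - \<eta>" using AP[of "n + 1"] by (simp add: \<eta>_def)
  then have "real (n + 1) *\<^sub>R \<eta> = - \<eta>" by (metis add_left_imp_eq diff_conv_add_uminus)
  then have "(real (n + 1) + 1) *\<^sub>R \<eta> = 0" by (simp only: scaleR_left_distrib) simp
  then have "\<eta> = 0" by (simp add: add_nonneg_eq_0_iff)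
  then show ?thesis using AP[OF p] by simp
qed

lemma scaleR_3: "3 *\<^sub>R x = x + x + (x :: 'a::real_vector)"
  using scaleR_left_distrib[of 2 1 x] by (simp add: scaleR_2)

lemma scaleR_4: "4 *\<^sub>R x = x + x + x + (x :: 'a::real_vector)"
  using scaleR_left_distrib[of 3 1 x] by (simp add: scaleR_3)

context jb_triple
begin

lemma triple_add_right: "triple x y (z + z') = triple x y z + triple x y z'"
  using triple_add_left[of z z' y x] by (simp add: triple_commute[of x])

lemma triple_scaleC_right: "triple x y (c *\<^sub>C z) = c *\<^sub>C triple x y z"
  using triple_scaleC_left[of c z y x] by (simp add: triple_commute[of x])

lemma triple_0 [simp]: "triple 0 y z = 0" "triple x 0 z = 0" "triple x y 0 = 0"
  using triple_scaleC_left[of 0 0 y z] triple_scaleC_mid[of x 0 0 z] triple_scaleC_right[of x y 0 0]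
  by simp_all

lemma triple_scaleR:
  "triple (r *\<^sub>R x) y z = r *\<^sub>R triple x y z"
  "triple x (r *\<^sub>R y) z = r *\<^sub>R triple x y z"
  "triple x y (r *\<^sub>R z) = r *\<^sub>R triple x y z"
  by (simp_all add: scaleR_scaleC triple_scaleC_left triple_scaleC_mid triple_scaleC_right)

lemma triple_minus:
  "triple (- x) y z = - triple x y z"
  "triple x (- y) z = - triple x y z"
  "triple x y (- z) = - triple x y z"
  using triple_scaleR(1)[of "-1" x y z] triple_scaleR(2)[of x "-1" y z] triple_scaleR(3)[of x y "-1" z] by simp_all

lemma triple_diff:
  "triple (x - x') y z = triple x y z - triple x' y z"
  "triple x (y - y') z = triple x y z - triple x y' z"
  "triple x y (z - z') = triple x y z - triple x y z'"
  using triple_add_left[of x "- x'"] triple_add_mid[of x y "- y'"] triple_add_right[of x y z "- z'"]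
  by (simp_all add: triple_minus)

lemmas triple_linear = triple_add_left triple_add_mid triple_add_right triple_diff triple_minus
  triple_scaleC_left triple_scaleC_mid triple_scaleC_right

lemma triple_sum_left: "triple (sum f A) y z = (\<Sum>a\<in>A. triple (f a) y z)"
  by (induction A rule: infinite_finite_induct) (auto simp: triple_add_left)

lemma triple_sum_mid: "triple x (sum f A) z = (\<Sum>a\<in>A. triple x (f a) z)"
  by (induction A rule: infinite_finite_induct) (auto simp: triple_add_mid)

lemma triple_sum_right: "triple x y (sum f A) = (\<Sum>a\<in>A. triple x y (f a))"
  by (induction A rule: infinite_finite_induct) (auto simp: triple_add_right)

lemma clinear_triple: "clinear (triple a b)"
  by (simp add: clinear_iff triple_add_right triple_scaleC_right)

lemma box_commutator:
  "triple a b (triple c d z) - triple c d (triple a b z)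
    = triple (triple a b c) d z - triple c (triple b a d) z"
  using triple_jordan[of a b c d z] by simp

text \<open>Antisymmetry of the commutator of two box operators.\<close>
lemma box_exchange:
  "triple (triple a b c) d z - triple c (triple b a d) z
    = triple a (triple d c b) z - triple (triple c d a) b z"
proof -
  have "triple (triple a b c) d z - triple c (triple b a d) z
      = - (triple c d (triple a b z) - triple a b (triple c d z))"
    using box_commutator[of a b c d z] by simp
  then show ?thesis by (simp only: box_commutator[of c d a b z]) simp
qed

definition odd_pow :: "'a \<Rightarrow> nat \<Rightarrow> 'a" where "odd_pow x n = (triple x x ^^ n) x"

lemma odd_pow_0 [simp]: "odd_pow x 0 = x"
  and odd_pow_Suc: "odd_pow x (Suc n) = triple x x (odd_pow x n)"
  by (simp_all add: odd_pow_def)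

abbreviation odd_span :: "'a \<Rightarrow> 'a set" where "odd_span x \<equiv> cvs.span (range (odd_pow x))"

lemma odd_span_eq_orbit_span: "odd_span x = orbit_span (triple x x) x"
  by (simp add: odd_pow_def[abs_def])

text \<open>Power associativity: the box operator of two odd powers depends only on the sum of the exponents.
In the induction step the operators \<open>E p\<close> with exponents \<open>p\<close> and \<open>n + 1 - p\<close> satisfy
\<open>E (i + j + k + 1) - E k = E i - E (k + l + i + 1)\<close> whenever \<open>i + j + k + l = n\<close>, by
\<open>box_exchange\<close>. The cases \<open>i = k = 0\<close> and \<open>j = l = 0\<close> are two reflections, which force all
\<open>E p\<close> to agree.\<close>

lemma odd_pow_box: "triple (odd_pow x a) (odd_pow x b) z = triple (odd_pow x (a + b)) x z"
proof -
  let ?P = "\<lambda>n. \<forall>a b z. a + b \<le> n \<longrightarrow>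
    triple (odd_pow x a) (odd_pow x b) z = triple (odd_pow x (a + b)) x z"
  have "?P n" for n
  proof (induction n)
    case (Suc n)
    have P: "triple (odd_pow x a) (odd_pow x b) z = triple (odd_pow x (a + b)) x z"
      if "a + b \<le> n" for a b z using Suc that by blast
    have Q: "triple (odd_pow x a) (odd_pow x b) (odd_pow x c) = odd_pow x (a + b + c + 1)"
      if "a + b + c \<le> n" for a b c
    proof -
      have "triple (odd_pow x a) (odd_pow x b) (odd_pow x c) = triple (odd_pow x c) (odd_pow x 0) (odd_pow x (a + b))"
        using P[of a b] that by (simp add: triple_commute[of _ x "odd_pow x c"])
      also have "\<dots> = triple x (odd_pow x c) (odd_pow x (a + b))"
        using P[of c 0] P[of 0 c] that by simp
      also have "\<dots> = triple (odd_pow x (a + b + c)) x x"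
        using P[of "a + b" c x] that by (simp add: triple_commute)
      finally show ?thesis
        by (simp add: odd_pow_Suc triple_commute)
    qed
    show ?case
    proof (intro allI impI)
      fix a b z assume ab: "a + b \<le> Suc n"
      show "triple (odd_pow x a) (odd_pow x b) z = triple (odd_pow x (a + b)) x z"
      proof (cases "a + b \<le> n")
        case True
        then show ?thesis using P by blast
      next
        case False
        define E where "E p = triple (odd_pow x p) (odd_pow x (n + 1 - p)) z" for p
        have rel: "E (i + j + k + 1) - E k = E i - E (k + l + i + 1)" if "i + j + k + l = n" for i j k l
        proof -
          have "n + 1 - (i + j + k + 1) = l" "n + 1 - k = i + j + l + 1" "n + 1 - i = l + k + j + 1"
            "n + 1 - (k + l + i + 1) = j" using that by auto
          then show ?thesis
            using box_exchange[of "odd_pow x i" "odd_pow x j" "odd_pow x k" "odd_pow x l" z] that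
            by (simp add: Q E_def add.commute add.left_commute)
        qed
        have "E (j + 1) + E (n + 1 - j) = 2 *\<^sub>R E 0" if "j \<le> n" for j
        proof -
          have "n - j + 1 = n + 1 - j" using that by simp
          then show ?thesis
            using rel[of 0 j 0 "n - j"] that by (simp add: scaleR_2 algebra_simps)
        qed
        moreover have "E i + E (n - i) = 2 *\<^sub>R E (n + 1)" if "i \<le> n" for i
          using rel[of i 0 "n - i" 0] that by (simp add: scaleR_2 algebra_simps)
        ultimately have "E p = E 0" if "p \<le> n + 1" for p
          using arithmetic_progression_of_reflections[of n E p] that by blast
        from this[of a] this[of "n + 1"] have "E a = E (n + 1)" using ab by simp
        moreover have "b = n + 1 - a" "a + b = n + 1" using False ab by auto
        ultimately show ?thesis by (simp add: E_def)
      qed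
    qed
  qed (simp add: odd_pow_def)
  then show ?thesis by blast
qed

text \<open>For eigenvectors \<open>y\<close> and \<open>w\<close> of \<open>triple x x\<close> with distinct real eigenvalues, this symmetry
says that \<open>y\<close> and \<open>w\<close> are orthogonal in the triple.\<close>

lemma odd_span_self_adjoint:
  assumes "y \<in> odd_span x" "w \<in> odd_span x"
  shows "triple (triple x x y) w z = triple y (triple x x w) z"
  using assms(1)
proof (induction rule: cvs.span_induct_alt)
  case (step c a y)
  then obtain m where m: "a = odd_pow x m" by auto
  have "triple (triple x x a) w z = triple a (triple x x w) z"
    using assms(2)
  proof (induction rule: cvs.span_induct_alt)
    case (step c b y)
    then obtain k where k: "b = odd_pow x k" by auto
    have "triple (odd_pow x (Suc m)) (odd_pow x k) z = triple (odd_pow x m) (odd_pow x (Suc k)) z"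
      by (simp only: odd_pow_box) simp
    then have "triple (triple x x a) b z = triple a (triple x x b) z"
      by (simp add: m k odd_pow_Suc)
    then show ?case using step by (simp add: triple_linear)
  qed simp
  then show ?case using step by (simp add: triple_linear)
qed simp

lemma box_no_jordan_chain:
  assumes "triple a a w = \<mu> *\<^sub>C w" "triple a a v = \<mu> *\<^sub>C v + w"
  shows "w = 0"
proof (rule ccontr)
  assume "w \<noteq> 0"
  then have "\<mu> \<in> \<real>" using assms(1) eigenvalue_in_spectrum triple_spectrum by blast
  then show False using hermitian_op_no_jordan_chain[OF triple_hermitian] assms \<open>w \<noteq> 0\<close> by blast
qed

lemma box_eigenvalue:
  assumes "triple a a v = \<mu> *\<^sub>C v" "v \<noteq> 0"
  obtains r where "r \<ge> 0" "\<mu> = of_real r"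
proof -
  have "\<mu> \<in> \<real> \<and> 0 \<le> Re \<mu>" using assms eigenvalue_in_spectrum triple_spectrum by blast
  then show ?thesis using that[of "Re \<mu>"] by simp
qed

lemma box_zero_imp_zero:
  assumes "\<And>z. triple a a z = 0"
  shows "a = 0"
proof -
  have "triple a a = (\<lambda>_. 0)" using assms by auto
  then have "onorm (triple a a) = 0" by (simp add: onorm_zero)
  then show ?thesis using triple_norm[of a] by simp
qed

text \<open>Write \<open>D z = triple a a z\<close> and \<open>Q z = triple a z a\<close>. If the cube of \<open>a\<close> vanishes, three instances of
the Jordan identity give \<open>2 D\<^sup>2 = Q\<^sup>2\<close> and \<open>D Q = 0\<close>, hence \<open>D\<^sup>3 = 0\<close>. A nilpotent Hermitian
operator is zero, and the norm of \<open>D\<close> is the square of the norm of \<open>a\<close>.\<close>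

lemma cube_zero_imp_zero:
  assumes a: "triple a a a = 0"
  shows "a = 0"
proof (rule box_zero_imp_zero)
  fix z
  let ?D = "triple a a" and ?Q = "\<lambda>z. triple a z a"
  have DD: "?D (?D z) + ?D (?D z) = ?Q (?Q z)" for z
    using triple_jordan[of z a a a a] a by (simp add: triple_commute algebra_simps)
  have DQ: "?D (?Q z) = - ?Q (?D z)" for z
    using triple_jordan[of a a a z a] a by (simp add: triple_commute algebra_simps)
  have "?D (?Q z) + ?D (?Q z) = ?Q (?D z)" for z
    using triple_jordan[of a z a a a] a by (simp add: triple_commute algebra_simps)
  then have "?D (?Q z) + ?D (?Q z) = - ?D (?Q z)" for z
    using DQ by (metis minus_minus)
  then have "3 *\<^sub>R ?D (?Q z) = 0" for z
    unfolding scaleR_3 by (metis ab_group_add_class.ab_left_minus)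
  then have DQ0: "?D (?Q z) = 0" for z by simp
  have "?D (?D (?D z)) + ?D (?D (?D z)) = 0" for z
    using DD[of z] DQ0 by (metis triple_add_right)
  then have D3: "?D (?D (?D z)) = 0" for z
    by (metis scaleR_2 scaleR_eq_0_iff zero_neq_numeral)
  have "?D (?D z) = 0" for z
    using box_no_jordan_chain[of a "?D (?D z)" 0 "?D z"] D3 by simp
  then show "?D z = 0"
    using box_no_jordan_chain[of a "?D z" 0 z] by simp
qed

section \<open>Peirce decomposition\<close>

text \<open>With \<open>D z = triple e e z\<close> and \<open>Q z = triple e z e\<close>, the Jordan identity gives \<open>D Q = Q D = Q\<close>
and \<open>D = 2 D\<^sup>2 - Q\<^sup>2\<close>. Multiplying the last equation by \<open>D\<close> eliminates \<open>Q\<close> and leaves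
\<open>D (2 D - 1) (D - 1) = 0\<close>.\<close>

lemma tripotent_cubic:
  assumes e: "tripotent triple e"
  shows "triple e e (triple e z e) = triple e z e"
    and "triple e (triple e e z) e = triple e z e"
    and "2 *\<^sub>R triple e e (triple e e (triple e e z)) = 3 *\<^sub>R triple e e (triple e e z) - triple e e z"
proof -
  let ?D = "triple e e" and ?Q = "\<lambda>z. triple e z e"
  have e': "triple e e e = e" using e by (simp add: tripotent_def)
  have 1: "?D (?Q z) = 2 *\<^sub>R ?Q z - ?Q (?D z)" for z
    using triple_jordan[of e e e z e] e' by (simp add: triple_commute scaleR_2 algebra_simps)
  have 2: "?Q z = 2 *\<^sub>R ?D (?Q z) - ?Q (?D z)" for z
    using triple_jordan[of e z e e e] e' by (simp add: triple_commute scaleR_2 algebra_simps)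
  show DQ: "?D (?Q z) = ?Q z" for z
  proof -
    have "?D (?Q z) - ?Q z = (?D (?Q z) + ?Q (?D z)) - (?Q z + ?Q (?D z))" by simp
    also have "\<dots> = 2 *\<^sub>R ?Q z - 2 *\<^sub>R ?D (?Q z)"
      using 1[of z] 2[of z] by (metis diff_add_cancel)
    finally have "3 *\<^sub>R (?D (?Q z) - ?Q z) = 0"
      by (simp add: scaleR_3 scaleR_2 algebra_simps)
    then show ?thesis by simp
  qed
  show "?Q (?D z) = ?Q z" using 1[of z] DQ[of z] by (simp add: scaleR_2)
  have D: "?D z = 2 *\<^sub>R ?D (?D z) - ?Q (?Q z)" for z
    using triple_jordan[of z e e e e] e' by (simp add: triple_commute scaleR_2 algebra_simps)
  have "?D (?D z) = 2 *\<^sub>R ?D (?D (?D z)) - ?Q (?Q z)"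
    using arg_cong[OF D[of z], of ?D] DQ by (simp add: triple_linear triple_scaleR)
  moreover have "?Q (?Q z) = 2 *\<^sub>R ?D (?D z) - ?D z" using D[of z] by (simp add: algebra_simps)
  ultimately show "2 *\<^sub>R ?D (?D (?D z)) = 3 *\<^sub>R ?D (?D z) - ?D z"
    by (simp add: scaleR_3 scaleR_2 algebra_simps)
qed

lemma peirce_decomposition:
  assumes e: "tripotent triple e"
  obtains x1 xh x0 where "x = x1 + xh + x0" "triple e e x1 = x1"
    "triple e e xh = (1/2) *\<^sub>R xh" "triple e e x0 = 0"
proof -
  \<comment> \<open>Lagrange interpolation at the three roots \<open>1\<close>, \<open>1/2\<close>, \<open>0\<close>: the components of \<open>x\<close> are
    \<open>2 D\<^sup>2 x - D x\<close>, \<open>4 D x - 4 D\<^sup>2 x\<close> and \<open>x - 3 D x + 2 D\<^sup>2 x\<close>.\<close>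
  define w where "w = triple e e x"
  define z where "z = triple e e w"
  have c: "triple e e z = (3/2) *\<^sub>R z - (1/2) *\<^sub>R w"
  proof -
    have "2 *\<^sub>R triple e e z = 3 *\<^sub>R z - w"
      using tripotent_cubic(3)[OF e, of x] by (simp add: w_def z_def)
    then have "(1/2) *\<^sub>R (2 *\<^sub>R triple e e z) = (1/2) *\<^sub>R (3 *\<^sub>R z - w)" by simp
    then show ?thesis by (simp add: scaleR_diff_right)
  qed
  have 1: "triple e e (2 *\<^sub>R z - w) = 2 *\<^sub>R z - w"
    by (simp add: triple_linear triple_scaleR c flip: z_def) (simp add: scaleR_2 scaleR_3 algebra_simps)
  have 2: "triple e e (4 *\<^sub>R w - 4 *\<^sub>R z) = (1/2) *\<^sub>R (4 *\<^sub>R w - 4 *\<^sub>R z)"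
    by (simp add: triple_linear triple_scaleR c flip: z_def) (simp add: algebra_simps flip: scaleR_left_distrib scaleR_left_diff_distrib)
  have 3: "triple e e (x - 3 *\<^sub>R w + 2 *\<^sub>R z) = 0"
    by (simp add: triple_linear triple_scaleR c flip: z_def w_def)
       (simp add: scaleR_2 scaleR_3 algebra_simps)
  have "x = (2 *\<^sub>R z - w) + (4 *\<^sub>R w - 4 *\<^sub>R z) + (x - 3 *\<^sub>R w + 2 *\<^sub>R z)"
    by (simp add: scaleR_2 scaleR_3 scaleR_4)
  then show ?thesis using that 1 2 3 by blast
qed

lemma op_exp_box_isometry:
  assumes "\<And>i. i \<in> I \<Longrightarrow> triple a a (x i) = r i *\<^sub>R x i"
  shows "norm (\<Sum>i\<in>I. cis (t * r i) *\<^sub>C x i) = norm (\<Sum>i\<in>I. x i)"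
proof -
  let ?S = "\<lambda>y. (\<i> * of_real t) *\<^sub>C triple a a y"
  have lin: "clinear ?S"
    by (simp add: clinear_iff scaleC_add_right triple_linear mult.commute)
  have "op_exp ?S (\<Sum>i\<in>I. x i) = (\<Sum>i\<in>I. exp (\<i> * of_real (t * r i)) *\<^sub>C x i)"
    by (rule op_exp_sum_eigenvectors[OF lin]) (simp add: assms scaleR_scaleC mult.assoc)
  moreover have "norm (op_exp ?S (\<Sum>i\<in>I. x i)) = norm (\<Sum>i\<in>I. x i)"
    using triple_hermitian[of a] by (simp add: hermitian_op_def)
  ultimately show ?thesis by (simp add: cis_conv_exp)
qed

text \<open>For \<open>\<zeta> = cis t\<close> the operator on the left is the isometry \<open>exp (2 \<i> t D)\<close> with \<open>D = triple e e\<close>. Its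
averages over roots of unity project onto the Peirce spaces without increasing the norm.\<close>

lemma peirce_rotation_isometry:
  assumes "triple e e x1 = x1" "triple e e xh = (1/2) *\<^sub>R xh" "triple e e x0 = 0" "cmod \<zeta> = 1"
  shows "norm (\<zeta>\<^sup>2 *\<^sub>C x1 + \<zeta> *\<^sub>C xh + x0) = norm (x1 + xh + x0)"
proof -
  obtain t where t: "\<zeta> = cis t" using assms(4) by (metis complex_norm_eq_1_exp cis_conv_exp)
  define x r where "x = (\<lambda>i::nat. if i = 0 then x0 else if i = 1 then xh else x1)"
    and "r = (\<lambda>i::nat. if i = 0 then 0 else if i = 1 then 1/2 else 1::real)"
  have I: "(\<Sum>i\<in>{0,1,2::nat}. f i) = f 0 + (f 1 + f 2)" for f :: "nat \<Rightarrow> 'a" by simp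
  have "norm (\<Sum>i\<in>{0,1,2}. cis (2 * t * r i) *\<^sub>C x i) = norm (\<Sum>i\<in>{0,1,2}. x i)"
    by (rule op_exp_box_isometry[of _ e]) (auto simp: x_def r_def assms)
  then show ?thesis
    by (simp add: I x_def r_def t power2_eq_square cis_mult algebra_simps)
qed

lemma norm_box_le: "norm (triple a a z) \<le> (norm a)\<^sup>2 * norm z"
  using onorm[of "triple a a" z] triple_hermitian[of a] triple_norm[of a]
  by (simp add: hermitian_op_def bounded_clinear_def)

text \<open>The lower bound comes from \<open>triple e e e = e\<close>. For the upper bound, \<open>D = triple e e\<close> is
\<open>1/2 - (P0 - P1) / 2\<close> in terms of the Peirce projections, and \<open>P0 - P1\<close> is the mean of the two
Peirce rotations by \<open>\<i>\<close> and \<open>-\<i>\<close>; so \<open>D\<close> is a contraction, and its norm is the square of the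
norm of \<open>e\<close>.\<close>

lemma norm_tripotent:
  assumes e: "tripotent triple e" and "e \<noteq> 0"
  shows "norm e = 1"
proof (rule antisym)
  have e': "triple e e e = e" using e by (simp add: tripotent_def)
  have "norm e \<le> (norm e)\<^sup>2 * norm e" using norm_box_le[of e e] e' by simp
  then have "1 \<le> (norm e)\<^sup>2" using \<open>e \<noteq> 0\<close> by simp
  then show "1 \<le> norm e" by (metis abs_norm_cancel abs_1 abs_le_square_iff one_power2)
  have "norm (triple e e z) \<le> 1 * norm z" for z
  proof -
    obtain x1 xh x0 where z: "z = x1 + xh + x0" and p: "triple e e x1 = x1"
      "triple e e xh = (1/2) *\<^sub>R xh" "triple e e x0 = 0"
      using peirce_decomposition[OF e] by metis
    let ?R = "\<lambda>\<zeta>. \<zeta>\<^sup>2 *\<^sub>C x1 + \<zeta> *\<^sub>C xh + x0"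
    have "4 *\<^sub>R triple e e z = 2 *\<^sub>R z - ?R \<i> - ?R (-\<i>)"
      by (simp add: z triple_linear p scaleR_2 algebra_simps scaleR_add_left[of 2 2, simplified] scaleR_scaleC[symmetric])
    then have "4 * norm (triple e e z) = norm (2 *\<^sub>R z - ?R \<i> - ?R (-\<i>))" by (metis abs_numeral norm_scaleR)
    also have "\<dots> \<le> norm (2 *\<^sub>R z) + norm (?R \<i>) + norm (?R (- \<i>))"
      by (meson norm_triangle_le_diff norm_triangle_ineq4 order_trans add_mono order_refl)
    also have "\<dots> = 4 * norm z"
      using peirce_rotation_isometry[OF p, of \<i>] peirce_rotation_isometry[OF p, of "-\<i>"] z by simp
    finally show ?thesis by simp
  qed
  then have "onorm (triple e e) \<le> 1" by (intro onorm_bound) auto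
  then have "(norm e)\<^sup>2 \<le> 1" by (simp add: triple_norm)
  then show "norm e \<le> 1" by (simp add: abs_square_le_1)
qed

text \<open>The commutator of \<open>triple e e\<close> with \<open>triple e u\<close> can be expanded in two ways: one expansion is
\<open>triple e u\<close> itself, in the other every term vanishes.\<close>

lemma tripotent_orthogonal:
  assumes e: "tripotent triple e" and u: "triple e e u = 0"
  shows "triple e u z = 0" and "triple u e z = 0"
proof -
  have e': "triple e e e = e" using e by (simp add: tripotent_def)
  have Q: "triple e u e = 0" using tripotent_cubic(2)[OF e, of u] u by simp
  have u': "triple u e e = 0" using u by (simp add: triple_commute)
  show "triple e u z = 0"
    using box_exchange[of e e e u z] by (simp add: e' u u' Q)
  show "triple u e z = 0"
    using box_exchange[of e e u e z] by (simp add: e' u u' Q)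
qed

text \<open>The operator \<open>triple e e\<close> acts on triple products like a derivation, with a minus sign in the
conjugate linear middle variable; so eigenvalues combine as \<open>i - j + k\<close>.\<close>

lemma peirce_fusion:
  assumes "triple e e x = i *\<^sub>R x" "triple e e y = j *\<^sub>R y" "triple e e z = k *\<^sub>R z"
  shows "triple e e (triple x y z) = (i - j + k) *\<^sub>R triple x y z"
  using triple_jordan[of e e x y z] by (simp add: assms triple_scaleR algebra_simps)

section \<open>Orthogonal families of tripotents\<close>

text \<open>Families are indexed because spectral decompositions are indexed by their spectral values.\<close>

definition orth_family :: "'i set \<Rightarrow> ('i \<Rightarrow> 'a) \<Rightarrow> bool"
  where "orth_family I e \<longleftrightarrow> (\<forall>i\<in>I. tripotent triple (e i) \<and> e i \<noteq> 0) \<and>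
    (\<forall>i\<in>I. \<forall>j\<in>I. i \<noteq> j \<longrightarrow> triple_orthogonal triple (e i) (e j))"

lemma orth_familyD:
  assumes "orth_family I e" "i \<in> I"
  shows "triple (e i) (e i) (e i) = e i" "e i \<noteq> 0" "tripotent triple (e i)"
    and "j \<in> I \<Longrightarrow> i \<noteq> j \<Longrightarrow> triple (e i) (e j) z = 0"
  using assms by (auto simp: orth_family_def tripotent_def triple_orthogonal_def)

lemma orth_family_box:
  assumes "orth_family I e" "i \<in> I" "j \<in> I"
  shows "triple (e i) (e i) (e j) = (if i = j then e i else 0)"
  using orth_familyD[OF assms(1,2)] orth_familyD(4)[OF assms(1,3,2)]
  by (auto simp: triple_commute[of "e i" "e i" "e j"])

lemma orth_family_subset: "orth_family I e \<Longrightarrow> J \<subseteq> I \<Longrightarrow> orth_family J e"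
  by (auto simp: orth_family_def subset_iff)

lemma orth_family_rotate:
  assumes "orth_family I e" "\<And>i. i \<in> I \<Longrightarrow> cmod (\<theta> i) = 1"
  shows "orth_family I (\<lambda>i. \<theta> i *\<^sub>C e i)"
proof -
  have "\<theta> i * cnj (\<theta> i) = 1" if "i \<in> I" for i
    using assms(2)[OF that] complex_norm_square[of "\<theta> i"] by simp
  then have "cnj (\<theta> i) * \<theta> i = 1" if "i \<in> I" for i
    using that by (simp add: mult.commute)
  moreover have "\<theta> i \<noteq> 0" if "i \<in> I" for i using assms(2)[OF that] by auto
  ultimately show ?thesis
    using assms(1) unfolding orth_family_def tripotent_def triple_orthogonal_def
    by (auto simp: triple_linear mult.assoc)
qed

lemma box_orth_sum:
  assumes "finite I" "orth_family I e"
  shows "triple (\<Sum>i\<in>I. c i *\<^sub>C e i) (\<Sum>i\<in>I. c i *\<^sub>C e i) z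
    = (\<Sum>i\<in>I. (cmod (c i))\<^sup>2 *\<^sub>R triple (e i) (e i) z)"
proof -
  have "triple (\<Sum>i\<in>I. c i *\<^sub>C e i) (\<Sum>i\<in>I. c i *\<^sub>C e i) z
      = (\<Sum>i\<in>I. \<Sum>j\<in>I. triple (c i *\<^sub>C e i) (c j *\<^sub>C e j) z)"
    by (simp only: triple_sum_left) (simp only: triple_sum_mid)
  also have "\<dots> = (\<Sum>i\<in>I. \<Sum>j\<in>I. if j = i then (cmod (c i))\<^sup>2 *\<^sub>R triple (e i) (e i) z else 0)"
  proof (intro sum.cong refl)
    fix i j assume "i \<in> I" "j \<in> I"
    moreover have "cnj (c i) * c i = of_real ((cmod (c i))\<^sup>2)"
      by (simp only: complex_norm_square mult.commute)
    ultimately show "triple (c i *\<^sub>C e i) (c j *\<^sub>C e j) z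
        = (if j = i then (cmod (c i))\<^sup>2 *\<^sub>R triple (e i) (e i) z else 0)"
      using orth_familyD(4)[OF assms(2), of i j] by (auto simp: triple_linear scaleR_scaleC)
  qed
  also have "\<dots> = (\<Sum>i\<in>I. (cmod (c i))\<^sup>2 *\<^sub>R triple (e i) (e i) z)"
    using assms(1) by (simp add: sum.delta)
  finally show ?thesis .
qed

lemma box_orth_sum_eigen:
  assumes "finite I" "orth_family I e" "j \<in> I"
  shows "triple (\<Sum>i\<in>I. c i *\<^sub>C e i) (\<Sum>i\<in>I. c i *\<^sub>C e i) (e j) = (cmod (c j))\<^sup>2 *\<^sub>R e j"
proof -
  have "(\<Sum>i\<in>I. (cmod (c i))\<^sup>2 *\<^sub>R triple (e i) (e i) (e j)) = (\<Sum>i\<in>I. if i = j then (cmod (c j))\<^sup>2 *\<^sub>R e j else 0)"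
    by (intro sum.cong refl) (auto simp: orth_family_box[OF assms(2) _ assms(3)])
  then show ?thesis using assms by (simp add: box_orth_sum)
qed

lemma cube_orth_sum:
  assumes "finite I" "orth_family I e"
  shows "triple (\<Sum>i\<in>I. c i *\<^sub>C e i) (\<Sum>i\<in>I. c i *\<^sub>C e i) (\<Sum>i\<in>I. c i *\<^sub>C e i)
    = (\<Sum>i\<in>I. (cmod (c i))\<^sup>2 *\<^sub>R (c i *\<^sub>C e i))"
proof -
  have "triple (\<Sum>i\<in>I. c i *\<^sub>C e i) (\<Sum>i\<in>I. c i *\<^sub>C e i) (\<Sum>j\<in>I. c j *\<^sub>C e j)
     = (\<Sum>j\<in>I. triple (\<Sum>i\<in>I. c i *\<^sub>C e i) (\<Sum>i\<in>I. c i *\<^sub>C e i) (c j *\<^sub>C e j))"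
    by (simp only: triple_sum_right)
  also have "\<dots> = (\<Sum>i\<in>I. (cmod (c i))\<^sup>2 *\<^sub>R (c i *\<^sub>C e i))"
    by (intro sum.cong refl) (simp add: triple_scaleC_right box_orth_sum_eigen[OF assms] scaleC_scaleR_commute)
  finally show ?thesis .
qed

lemma norm_orth_sum_ge:
  assumes "finite I" "orth_family I e" "j \<in> I"
  shows "cmod (c j) \<le> norm (\<Sum>i\<in>I. c i *\<^sub>C e i)"
proof -
  let ?x = "\<Sum>i\<in>I. c i *\<^sub>C e i"
  have "(cmod (c j))\<^sup>2 * norm (e j) \<le> (norm ?x)\<^sup>2 * norm (e j)"
    using norm_box_le[of ?x "e j"] box_orth_sum_eigen[OF assms] by simp
  then have "(cmod (c j))\<^sup>2 \<le> (norm ?x)\<^sup>2"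
    using orth_familyD(2)[OF assms(2,3)] by simp
  then show ?thesis by (simp add: power2_le_iff_abs_le)
qed

lemma tripotent_unimodular_sum:
  assumes "finite I" "orth_family I e" "\<And>i. i \<in> I \<Longrightarrow> cmod (c i) = 1"
  shows "tripotent triple (\<Sum>i\<in>I. c i *\<^sub>C e i)"
  using assms(3) unfolding tripotent_def cube_orth_sum[OF assms(1,2)] by (intro sum.cong) auto

text \<open>Coefficients of modulus one give a tripotent, whose norm is at most one. Every point of the
polydisc is a convex combination of points of the torus: a coefficient \<open>r \<theta>\<close> with \<open>0 \<le> r \<le> 1\<close> lies
between \<open>\<theta>\<close> and \<open>- \<theta>\<close>. The set \<open>J\<close> collects the coordinates that are not yet unimodular.\<close>

lemma norm_orth_sum_le_1:
  assumes "finite I" "orth_family I e" "\<And>i. i \<in> I \<Longrightarrow> cmod (c i) \<le> 1"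
  shows "norm (\<Sum>i\<in>I. c i *\<^sub>C e i) \<le> 1"
proof -
  have "norm (\<Sum>i\<in>I. c i *\<^sub>C e i) \<le> 1"
    if "finite J" "J \<subseteq> I" "\<And>i. i \<in> I \<Longrightarrow> cmod (c i) \<le> 1" "\<And>i. i \<in> I - J \<Longrightarrow> cmod (c i) = 1" for J c
    using that
  proof (induction J arbitrary: c rule: finite_induct)
    case empty
    then have "tripotent triple (\<Sum>i\<in>I. c i *\<^sub>C e i)"
      using tripotent_unimodular_sum[OF assms(1,2)] by auto
    then show ?case using norm_tripotent by (metis norm_zero order_refl zero_le_one)
  next
    case (insert k J)
    define \<theta> where "\<theta> = (if c k = 0 then 1 else sgn (c k))"
    define r where "r = cmod (c k)"
    have \<theta>: "cmod \<theta> = 1" "c k = of_real r * \<theta>"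
      by (auto simp: \<theta>_def r_def norm_sgn) (metis of_real_def sgn_div_norm mult.commute norm_eq_zero scaleR_conv_of_real nonzero_eq_divide_eq of_real_eq_0_iff divide_complex_def of_real_inverse)
    have r: "0 \<le> r" "r \<le> 1" using insert.prems(1,2) by (auto simp: r_def)
    define cp where "cp = c(k := \<theta>)"
    define cm where "cm = c(k := - \<theta>)"
    have b: "norm (\<Sum>i\<in>I. cp i *\<^sub>C e i) \<le> 1" "norm (\<Sum>i\<in>I. cm i *\<^sub>C e i) \<le> 1"
      using insert.prems insert.hyps(2) \<theta>(1) by (auto intro!: insert.IH simp: cp_def cm_def)
    have pt: "c i *\<^sub>C e i = ((1 + r) / 2) *\<^sub>R (cp i *\<^sub>C e i) + ((1 - r) / 2) *\<^sub>R (cm i *\<^sub>C e i)" for i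
    proof -
      have "c i = of_real ((1 + r) / 2) * cp i + of_real ((1 - r) / 2) * cm i"
        by (auto simp: cp_def cm_def \<theta>(2) field_simps)
      then show ?thesis by (simp add: scaleR_scaleC scaleC_add_left[symmetric])
    qed
    have "(\<Sum>i\<in>I. c i *\<^sub>C e i) = ((1 + r) / 2) *\<^sub>R (\<Sum>i\<in>I. cp i *\<^sub>C e i) + ((1 - r) / 2) *\<^sub>R (\<Sum>i\<in>I. cm i *\<^sub>C e i)"
      unfolding scaleR_sum_right sum.distrib[symmetric] by (intro sum.cong refl pt)
    also have "norm \<dots> \<le> ((1 + r) / 2) * 1 + ((1 - r) / 2) * 1"
      using b r by (intro norm_triangle_mono) (auto intro!: mult_left_mono[where b = "1::real", simplified])
    finally show ?case by (simp add: field_simps)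
  qed
  from this[of I c] assms show ?thesis by auto
qed

lemma norm_orth_sum_le:
  assumes "finite I" "orth_family I e" "\<And>i. i \<in> I \<Longrightarrow> cmod (c i) \<le> K" "0 \<le> K"
  shows "norm (\<Sum>i\<in>I. c i *\<^sub>C e i) \<le> K"
proof (cases "K = 0")
  case True
  then show ?thesis using assms(3) by simp
next
  case False
  then have "K > 0" using assms(4) by simp
  have "(\<Sum>i\<in>I. c i *\<^sub>C e i) = K *\<^sub>R (\<Sum>i\<in>I. (c i / of_real K) *\<^sub>C e i)"
    using False by (simp add: cvs.scale_sum_right scaleR_scaleC)
  moreover have "norm (\<Sum>i\<in>I. (c i / of_real K) *\<^sub>C e i) \<le> 1"
    using assms(3) \<open>K > 0\<close> by (intro norm_orth_sum_le_1[OF assms(1,2)]) (simp add: norm_divide)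
  ultimately show ?thesis
    using \<open>K > 0\<close> by simp
qed

section \<open>Spectral decomposition\<close>

lemma peirce_unique:
  assumes "a1 + ah + a0 = 0" "triple e e a1 = a1" "triple e e ah = (1/2) *\<^sub>R ah" "triple e e a0 = 0"
  shows "a1 = 0" "ah = 0" "a0 = 0"
proof -
  have "a1 + (1/2) *\<^sub>R ah = triple e e (a1 + ah + a0)"
    by (simp add: triple_add_right assms(2-4))
  then have 1: "a1 + (1/2) *\<^sub>R ah = 0" by (simp add: assms(1))
  have "a1 + (1/4) *\<^sub>R ah = triple e e (a1 + (1/2) *\<^sub>R ah)"
    by (simp add: triple_add_right triple_scaleR assms(2-4))
  then have 2: "a1 + (1/4) *\<^sub>R ah = 0" by (simp add: 1)
  have "(1/4) *\<^sub>R ah = (a1 + (1/2) *\<^sub>R ah) - (a1 + (1/4) *\<^sub>R ah)"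
    by (simp add: scaleR_left_diff_distrib[symmetric])
  then show "ah = 0" using 1 2 by simp
  then show "a1 = 0" using 1 by simp
  then show "a0 = 0" using assms \<open>ah = 0\<close> by simp
qed

text \<open>The operators \<open>triple w w\<close> and \<open>triple y y\<close> commute and add up, with weight \<open>s\<^sup>2\<close>, to the given box
operator. On a component of \<open>u\<close> in the Peirce \<open>k\<close>-space of \<open>w\<close> with \<open>k > 0\<close>, \<open>triple y y\<close> would
have the negative eigenvalue \<open>- k s\<^sup>2\<close>, so only the Peirce \<open>0\<close>-component survives.\<close>

lemma box_kernel_orth_summand:
  assumes w: "tripotent triple w" and orth: "\<And>z. triple w y z = 0" "\<And>z. triple y w z = 0"
    and s: "s > 0" and ker: "triple (s *\<^sub>R w + y) (s *\<^sub>R w + y) u = 0"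
  shows "triple w w u = 0"
proof -
  obtain u1 uh u0 where u: "u = u1 + uh + u0" and p: "triple w w u1 = u1"
    "triple w w uh = (1/2) *\<^sub>R uh" "triple w w u0 = 0"
    using peirce_decomposition[OF w] by metis
  have box: "triple (s *\<^sub>R w + y) (s *\<^sub>R w + y) z = s\<^sup>2 *\<^sub>R triple w w z + triple y y z" for z
    by (simp add: triple_linear triple_scaleR orth power2_eq_square)
  have comm: "triple w w (triple y y z) = triple y y (triple w w z)" for z
    using box_commutator[of w w y y z] orth by (simp add: triple_commute[of w w y])
  have "(s\<^sup>2 *\<^sub>R u1 + triple y y u1) + ((s\<^sup>2 / 2) *\<^sub>R uh + triple y y uh) + triple y y u0 = 0"
    using ker unfolding box by (simp add: u triple_linear p scaleR_add_right algebra_simps)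
  then have 1: "s\<^sup>2 *\<^sub>R u1 + triple y y u1 = 0" and 2: "(s\<^sup>2 / 2) *\<^sub>R uh + triple y y uh = 0"
    by (rule peirce_unique[where e = w]; simp add: triple_linear triple_scaleR comm p scaleR_add_right)+
  have neg: "v = 0" if "r *\<^sub>R v + triple y y v = 0" "r > 0" for v r
  proof (rule ccontr)
    assume "v \<noteq> 0"
    have "triple y y v = of_real (- r) *\<^sub>C v" using that(1) by (simp add: scaleC_of_real add_eq_0_iff)
    then obtain t where "t \<ge> 0" "complex_of_real (- r) = of_real t"
      using box_eigenvalue[OF _ \<open>v \<noteq> 0\<close>] by metis
    then have "- r = t" by (simp only: of_real_eq_iff)
    then show False using \<open>r > 0\<close> \<open>t \<ge> 0\<close> by simp
  qed
  have "u1 = 0" using neg[OF 1] s by simp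
  moreover have "uh = 0" using neg[OF 2] s by simp
  ultimately show ?thesis by (simp add: u p)
qed

end

locale finite_dim_jb_triple = jb_triple triple
  for triple :: "'a::complex_banach \<Rightarrow> 'a \<Rightarrow> 'a \<Rightarrow> 'a" +
  assumes finite_dim: "complex_finite_dim TYPE('a)"
begin

lemma box_eigenvector_decomposition:
  assumes W: "cvs.subspace W" "\<And>v. v \<in> W \<Longrightarrow> triple a a v \<in> W" and "y \<in> W"
  obtains M f where "finite M" "\<And>\<mu>. \<mu> \<in> M \<Longrightarrow> f \<mu> \<in> W"
    "\<And>\<mu>. \<mu> \<in> M \<Longrightarrow> triple a a (f \<mu>) = \<mu> *\<^sub>C f \<mu>" "y = (\<Sum>\<mu>\<in>M. f \<mu>)"
proof -
  obtain p where p: "p \<noteq> 0" "op_poly (triple a a) p y = 0"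
    using finite_dim_annihilating_poly[OF finite_dim clinear_triple] by blast
  have "\<exists>M f. finite M \<and> (\<forall>\<mu>\<in>M. f \<mu> \<in> W \<and> triple a a (f \<mu>) = \<mu> *\<^sub>C f \<mu>) \<and> y = (\<Sum>\<mu>\<in>M. f \<mu>)"
    by (rule eigenvector_decomposition_of_op_poly[OF clinear_triple _ W p(1) assms(3) p(2)])
       (rule box_no_jordan_chain)
  then show ?thesis using that by blast
qed

text \<open>The operator \<open>triple x x\<close> is diagonalisable on the span of the odd powers of \<open>x\<close>, with
non-negative eigenvalues. Its eigencomponents \<open>f \<mu>\<close> of \<open>x\<close> are orthogonal by
\<open>odd_span_self_adjoint\<close>, hence the cube of \<open>f \<mu>\<close> is \<open>triple x x (f \<mu>) = \<mu> f \<mu>\<close>, and rescaling by the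
root of \<open>\<mu>\<close> yields tripotents. The component at \<open>\<mu> = 0\<close> has cube zero and drops out. The
spectral values \<open>s\<close> are the square roots of the eigenvalues.\<close>

theorem spectral_decomposition:
  obtains S e where "finite S" "\<And>s. s \<in> S \<Longrightarrow> s > 0" "orth_family S e"
    "\<And>s. s \<in> S \<Longrightarrow> e s \<in> odd_span x" "x = (\<Sum>s\<in>S. s *\<^sub>R e s)"
proof -
  have sub: "cvs.subspace (odd_span x)" by simp
  have inv: "triple x x v \<in> odd_span x" if "v \<in> odd_span x" for v
    using that orbit_span_invariant[OF clinear_triple] unfolding odd_span_eq_orbit_span by blast
  have "x \<in> odd_span x" unfolding odd_span_eq_orbit_span by (rule orbit_span_base)
  from box_eigenvector_decomposition[OF sub inv this] obtain M f where
    M: "finite M" "\<And>\<mu>. \<mu> \<in> M \<Longrightarrow> f \<mu> \<in> odd_span x"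
    "\<And>\<mu>. \<mu> \<in> M \<Longrightarrow> triple x x (f \<mu>) = \<mu> *\<^sub>C f \<mu>" and x: "x = (\<Sum>\<mu>\<in>M. f \<mu>)"
    by metis
  have real: "\<exists>r\<ge>0. \<mu> = of_real r" if "\<mu> \<in> M" "f \<mu> \<noteq> 0" for \<mu>
    using box_eigenvalue[OF M(3)[OF that(1)] that(2)] by blast
  have orth: "triple (f \<mu>) (f \<nu>) z = 0" if "\<mu> \<in> M" "\<nu> \<in> M" "\<mu> \<noteq> \<nu>" for \<mu> \<nu> z
  proof (cases "f \<mu> = 0 \<or> f \<nu> = 0")
    case False
    then have "cnj \<nu> = \<nu>" using real that by force
    then have "(\<mu> - \<nu>) *\<^sub>C triple (f \<mu>) (f \<nu>) z = 0"
      using odd_span_self_adjoint[of "f \<mu>" x "f \<nu>" z] M that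
      by (simp add: triple_linear cvs.scale_left_diff_distrib)
    then show ?thesis using that by simp
  qed auto
  have cube: "triple (f \<mu>) (f \<mu>) (f \<mu>) = \<mu> *\<^sub>C f \<mu>" if "\<mu> \<in> M" for \<mu>
  proof -
    have "\<mu> *\<^sub>C f \<mu> = (\<Sum>\<alpha>\<in>M. \<Sum>\<beta>\<in>M. triple (f \<alpha>) (f \<beta>) (f \<mu>))"
    proof -
      have "\<mu> *\<^sub>C f \<mu> = triple (\<Sum>\<alpha>\<in>M. f \<alpha>) (\<Sum>\<beta>\<in>M. f \<beta>) (f \<mu>)"
        using M(3)[OF that] by (simp flip: x)
      then show ?thesis by (simp only: triple_sum_left) (simp only: triple_sum_mid)
    qed
    also have "\<dots> = (\<Sum>\<alpha>\<in>M. \<Sum>\<beta>\<in>M. if \<alpha> = \<mu> then (if \<beta> = \<mu> then triple (f \<mu>) (f \<mu>) (f \<mu>) else 0) else 0)"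
    proof (intro sum.cong refl)
      fix \<alpha> \<beta> assume "\<alpha> \<in> M" "\<beta> \<in> M"
      then show "triple (f \<alpha>) (f \<beta>) (f \<mu>) = (if \<alpha> = \<mu> then (if \<beta> = \<mu> then triple (f \<mu>) (f \<mu>) (f \<mu>) else 0) else 0)"
        using orth that by (cases "\<alpha> = \<beta>") (auto simp: triple_commute[of "f \<beta>" "f \<beta>" "f \<mu>"])
    qed
    also have "\<dots> = (\<Sum>\<alpha>\<in>M. if \<alpha> = \<mu> then triple (f \<mu>) (f \<mu>) (f \<mu>) else 0)"
    proof (intro sum.cong refl)
      fix \<alpha>
      show "(\<Sum>\<beta>\<in>M. if \<alpha> = \<mu> then (if \<beta> = \<mu> then triple (f \<mu>) (f \<mu>) (f \<mu>) else 0) else 0)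
          = (if \<alpha> = \<mu> then triple (f \<mu>) (f \<mu>) (f \<mu>) else 0)"
        using M(1) that by (cases "\<alpha> = \<mu>") simp_all
    qed
    also have "\<dots> = triple (f \<mu>) (f \<mu>) (f \<mu>)"
      using M(1) that by simp
    finally show ?thesis by simp
  qed
  define N where "N = {\<mu> \<in> M. f \<mu> \<noteq> 0}"
  have pos: "0 < Re \<mu> \<and> of_real (Re \<mu>) = \<mu>" if "\<mu> \<in> N" for \<mu>
  proof -
    have "\<mu> \<in> M" "f \<mu> \<noteq> 0" using that by (auto simp: N_def)
    moreover have "\<mu> \<noteq> 0"
      using cube[OF \<open>\<mu> \<in> M\<close>] cube_zero_imp_zero[of "f \<mu>"] \<open>f \<mu> \<noteq> 0\<close> by auto
    ultimately show ?thesis using real[of \<mu>] by auto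
  qed
  define S where "S = (\<lambda>\<mu>. sqrt (Re \<mu>)) ` N"
  define e where "e s = (1 / s) *\<^sub>R f (of_real (s\<^sup>2))" for s
  have S: "s > 0 \<and> of_real (s\<^sup>2) \<in> N" if s: "s \<in> S" for s
  proof -
    obtain \<mu> where "\<mu> \<in> N" "s = sqrt (Re \<mu>)" using s by (auto simp: S_def)
    then show ?thesis using pos[of \<mu>] by (simp add: real_sqrt_pow2 less_imp_le del: of_real_power)
  qed
  have S': "s > 0" "of_real (s\<^sup>2) \<in> M" "f (of_real (s\<^sup>2)) \<noteq> 0" if "s \<in> S" for s
    using S[OF that] by (auto simp: N_def)
  show ?thesis
  proof
    show "finite S" using M(1) by (simp add: S_def N_def)
    show "s > 0" if "s \<in> S" for s using S that by blast
    show "e s \<in> odd_span x" if "s \<in> S" for s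
      unfolding e_def scaleR_scaleC using S'[OF that] M(2) cvs.span_scale by blast
    show "orth_family S e"
      unfolding orth_family_def
    proof (intro conjI ballI impI)
      fix s assume s: "s \<in> S"
      note S's = S'[OF s]
      have "triple (e s) (e s) (e s) = e s"
        using cube[OF S's(2)] S's(1)
        by (simp add: e_def triple_scaleR scaleC_of_real power2_eq_square flip: of_real_power of_real_mult)
      then show "tripotent triple (e s)" by (simp add: tripotent_def)
      show "e s \<noteq> 0" using S's by (simp add: e_def)
    next
      fix s t assume st: "s \<in> S" "t \<in> S" "s \<noteq> t"
      then have "s\<^sup>2 \<noteq> t\<^sup>2" using S'(1)[OF st(1)] S'(1)[OF st(2)] by simp
      then have "complex_of_real (s\<^sup>2) \<noteq> of_real (t\<^sup>2)" by (metis of_real_eq_iff)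
      then show "triple_orthogonal triple (e s) (e t)"
        using orth S'(2) st by (simp add: triple_orthogonal_def e_def triple_scaleR)
    qed
    have "x = sum f N"
      unfolding N_def by (subst x, rule sum.mono_neutral_right) (use M(1) in auto)
    also have "\<dots> = (\<Sum>s\<in>S. f (of_real (s\<^sup>2)))"
      by (rule sum.reindex_bij_witness[of _ "\<lambda>s. of_real (s\<^sup>2)" "\<lambda>\<mu>. sqrt (Re \<mu>)"])
         (use S pos in \<open>auto simp: S_def less_imp_le simp del: of_real_power\<close>)
    also have "\<dots> = (\<Sum>s\<in>S. s *\<^sub>R e s)"
      using S'(1) by (intro sum.cong refl) (force simp: e_def)
    finally show "x = (\<Sum>s\<in>S. s *\<^sub>R e s)" .
  qed
qed

lemma spectral_value_le_norm:
  assumes "finite S" "orth_family S e" "s \<in> S" "s > 0"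
  shows "s \<le> norm (\<Sum>s\<in>S. s *\<^sub>R e s)"
  using norm_orth_sum_ge[OF assms(1-3), of "\<lambda>s. of_real s"] assms(4) by (simp add: scaleR_scaleC)

text \<open>Both conditions say that \<open>y\<close> and \<open>u\<close> are orthogonal; the passage from one to the other goes
through the spectral tripotents of \<open>y\<close>, each of which is orthogonal to \<open>u\<close>.\<close>

lemma box_kernel_symmetric:
  assumes "triple y y u = 0"
  shows "triple u u y = 0"
proof -
  obtain S e where S: "finite S" "\<And>s. s \<in> S \<Longrightarrow> s > 0" "orth_family S e" "y = (\<Sum>s\<in>S. s *\<^sub>R e s)"
    using spectral_decomposition by metis
  have "triple u u (e s) = 0" if "s \<in> S" for s
  proof -
    define y' where "y' = (\<Sum>t\<in>S - {s}. t *\<^sub>R e t)"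
    have y: "y = s *\<^sub>R e s + y'" using S that by (simp add: y'_def sum.remove[of S s])
    have "triple (e s) y' z = 0" "triple y' (e s) z = 0" for z
      using that orth_familyD(4)[OF S(3)]
      by (auto simp: y'_def triple_sum_left triple_sum_mid triple_scaleR intro!: sum.neutral)
    then have "triple (e s) (e s) u = 0"
      using box_kernel_orth_summand[of "e s" y' s u] orth_familyD(3)[OF S(3) that] S(2)[OF that] assms
      by (simp add: y)
    then have "triple (e s) u u = 0" by (rule tripotent_orthogonal[OF orth_familyD(3)[OF S(3) that]])
    then show ?thesis by (simp add: triple_commute[of u u])
  qed
  then show ?thesis by (simp add: S(4) triple_sum_right triple_scaleR)
qed

section \<open>Discs in the unit ball around a tripotent\<close>

text \<open>Averaging the box operators of \<open>u + y\<close> and \<open>u - y\<close> cancels the mixed terms, so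
\<open>triple u u + triple y y\<close> is a contraction. On the Peirce \<open>1\<close>-space of \<open>u\<close> the first summand is the
identity, while the second one preserves this space and has non-negative eigenvalues there;
hence it vanishes there, in particular at \<open>u\<close>, and \<open>y\<close> is orthogonal to \<open>u\<close>.\<close>

lemma tripotent_no_perturbation:
  assumes u: "tripotent triple u" and y: "triple u u y = k *\<^sub>R y" "k \<noteq> 0"
    and n: "norm (u + y) \<le> 1" "norm (u - y) \<le> 1"
  shows "y = 0"
proof -
  let ?W = "{v. triple u u v = v}"
  have u': "triple u u u = u" using u by (simp add: tripotent_def)
  have W: "cvs.subspace ?W"
    by (auto simp: cvs.subspace_def triple_linear)
  have inv: "triple y y v \<in> ?W" if "v \<in> ?W" for v
    using peirce_fusion[of u y k y k v 1] y that by simp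
  have le: "norm (v + triple y y v) \<le> norm v" if "v \<in> ?W" for v
  proof -
    have "2 *\<^sub>R (v + triple y y v) = triple (u + y) (u + y) v + triple (u - y) (u - y) v"
      using that by (simp add: triple_linear scaleR_2 algebra_simps)
    then have "2 * norm (v + triple y y v) = norm (triple (u + y) (u + y) v + triple (u - y) (u - y) v)"
      by (metis abs_numeral norm_scaleR)
    also have "\<dots> \<le> (norm (u + y))\<^sup>2 * norm v + (norm (u - y))\<^sup>2 * norm v"
      by (intro norm_triangle_mono norm_box_le)
    also have "\<dots> \<le> 1 * norm v + 1 * norm v"
      using n by (intro add_mono mult_right_mono) (auto simp: abs_square_le_1)
    finally show ?thesis by simp
  qed
  have "u \<in> ?W" using u' by simp
  obtain M f where M: "finite M" "\<And>\<mu>. \<mu> \<in> M \<Longrightarrow> f \<mu> \<in> ?W"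
    "\<And>\<mu>. \<mu> \<in> M \<Longrightarrow> triple y y (f \<mu>) = \<mu> *\<^sub>C f \<mu>" "u = (\<Sum>\<mu>\<in>M. f \<mu>)"
    by (rule box_eigenvector_decomposition[OF W inv \<open>u \<in> ?W\<close>], assumption) (rule that)
  have "triple y y (f \<mu>) = 0" if mu: "\<mu> \<in> M" for \<mu>
  proof (cases "f \<mu> = 0")
    case False
    obtain r where r: "r \<ge> 0" "\<mu> = of_real r" using box_eigenvalue[OF M(3)[OF mu] False] .
    have "f \<mu> + triple y y (f \<mu>) = (1 + r) *\<^sub>R f \<mu>"
      using M(3)[OF mu] r by (simp add: scaleC_of_real algebra_simps)
    then have "\<bar>1 + r\<bar> * norm (f \<mu>) \<le> norm (f \<mu>)" using le[OF M(2)[OF mu]] by simp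
    then have "r = 0" using False r(1) by simp
    then show ?thesis using M(3)[OF mu] r by simp
  qed simp
  then have "triple y y u = 0" by (simp add: M(4) triple_sum_right)
  then have "triple u u y = 0" by (rule box_kernel_symmetric)
  then show ?thesis using y by simp
qed

lemma norm_sum4_le:
  assumes "4 *\<^sub>R x = p + q + r + s" "norm p \<le> 1" "norm q \<le> 1" "norm r \<le> 1" "norm s \<le> 1"
  shows "norm (x :: 'a) \<le> 1"
proof -
  have "4 * norm x = norm (p + q + r + s)" using assms(1) by (metis abs_numeral norm_scaleR)
  also have "\<dots> \<le> 1 + 1 + 1 + 1" using assms by (intro norm_triangle_mono)
  finally show ?thesis by simp
qed

text \<open>A disc in the closed unit ball centred at \<open>u + b\<close>, where \<open>b\<close> is orthogonal to \<open>u\<close>, has a direction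
orthogonal to \<open>u\<close>. Averages over the four Peirce rotations of order dividing four move the
disc: weighted by \<open>\<zeta>\<^sup>2\<close> they isolate \<open>u + \<mu> a1\<close>, and when the disc is turned along with the
rotation they isolate \<open>u + \<mu> ah\<close>. Both remain in the unit ball, so \<open>tripotent_no_perturbation\<close>
kills the Peirce components \<open>a1\<close> and \<open>ah\<close> of \<open>a\<close>.\<close>

theorem disc_around_tripotent_orthogonal:
  assumes u: "tripotent triple u" and b: "triple u u b = 0"
    and n: "\<And>\<zeta>. cmod \<zeta> = 1 \<Longrightarrow> norm (u + b + \<zeta> *\<^sub>C a) \<le> 1"
  shows "triple u u a = 0"
proof -
  have u': "triple u u u = u" using u by (simp add: tripotent_def)
  obtain a1 ah a0 where a: "a = a1 + ah + a0" and p: "triple u u a1 = a1"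
    "triple u u ah = (1/2) *\<^sub>R ah" "triple u u a0 = 0"
    using peirce_decomposition[OF u] by metis
  define R where "R \<zeta> \<mu> = \<zeta>\<^sup>2 *\<^sub>C (u + \<mu> *\<^sub>C a1) + \<zeta> *\<^sub>C (\<mu> *\<^sub>C ah) + (b + \<mu> *\<^sub>C a0)" for \<zeta> \<mu>
  have R: "norm (R \<zeta> \<mu>) \<le> 1" if "cmod \<zeta> = 1" "cmod \<mu> = 1" for \<zeta> \<mu>
  proof -
    have "norm (R \<zeta> \<mu>) = norm ((u + \<mu> *\<^sub>C a1) + \<mu> *\<^sub>C ah + (b + \<mu> *\<^sub>C a0))"
      unfolding R_def by (rule peirce_rotation_isometry[of u])
        (simp_all add: triple_linear u' p b that scaleC_scaleR_commute)
    also have "(u + \<mu> *\<^sub>C a1) + \<mu> *\<^sub>C ah + (b + \<mu> *\<^sub>C a0) = u + b + \<mu> *\<^sub>C a"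
      by (simp add: a scaleC_add_right)
    finally show ?thesis using n[OF that(2)] by simp
  qed
  have "norm (u + \<mu> *\<^sub>C a1) \<le> 1" if "cmod \<mu> = 1" for \<mu>
  proof (rule norm_sum4_le)
    show "4 *\<^sub>R (u + \<mu> *\<^sub>C a1) = R 1 \<mu> + (- R \<i> \<mu>) + R (- 1) \<mu> + (- R (- \<i>) \<mu>)"
      by (simp add: R_def scaleR_4 scaleC_add_right)
  qed (simp_all add: R that)
  from this[of 1] this[of "-1"] have "a1 = 0"
    by (intro tripotent_no_perturbation[OF u, of a1 1]) (simp_all add: p)
  moreover have "norm (u + \<mu> *\<^sub>C ah) \<le> 1" if "cmod \<mu> = 1" for \<mu>
  proof (rule norm_sum4_le)
    show "4 *\<^sub>R (u + \<mu> *\<^sub>C ah)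
        = R 1 \<mu> + (- R \<i> (\<i> * \<mu>)) + R (- 1) (- \<mu>) + (- R (- \<i>) (- \<i> * \<mu>))"
      by (simp add: R_def scaleR_4 scaleC_add_right algebra_simps)
  qed (simp_all add: R that norm_mult)
  from this[of 1] this[of "-1"] have "ah = 0"
    by (intro tripotent_no_perturbation[OF u, of ah "1/2"]) (simp_all add: p)
  ultimately show ?thesis by (simp add: a p)
qed

end

section \<open>Norming functionals\<close>

definition sublinear :: "('a::real_vector \<Rightarrow> real) \<Rightarrow> bool"
  where "sublinear p \<longleftrightarrow> (\<forall>v w. p (v + w) \<le> p v + p w) \<and> (\<forall>t\<ge>0. \<forall>v. p (t *\<^sub>R v) = t * p v)"

lemma sublinearD:
  assumes "sublinear p"
  shows "p (v + w) \<le> p v + p w" "t \<ge> 0 \<Longrightarrow> p (t *\<^sub>R v) = t * p v" "p 0 = 0" "0 \<le> p v + p (- v)"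
proof -
  show 1: "p (v + w) \<le> p v + p w" for v w using assms by (auto simp: sublinear_def)
  show 2: "t \<ge> 0 \<Longrightarrow> p (t *\<^sub>R v) = t * p v" for t v using assms by (auto simp: sublinear_def)
  show 3: "p 0 = 0" using 2[of 0 0] by simp
  show "0 \<le> p v + p (- v)" using 1[of v "- v"] 3 by simp
qed

text \<open>The minorant is \<open>q y = inf (p (y + t b) - t p b)\<close> over \<open>t \<ge> 0\<close>; taking \<open>t = 1\<close> at \<open>y = - b\<close> gives the
last claim, which makes \<open>q\<close> linear on the line through \<open>b\<close>. Linearity on a line passes to every
smaller sublinear functional, so finitely many such steps produce a functional that is linear on
a whole finite-dimensional space.\<close>

lemma sublinear_minorant_affine_at:
  assumes p: "sublinear (p :: 'a::real_vector \<Rightarrow> real)"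
  shows "\<exists>q. sublinear q \<and> (\<forall>v. q v \<le> p v) \<and> q (- b) \<le> - p b"
proof -
  define A where "A y t = p (y + t *\<^sub>R b) - t * p b" for y and t :: real
  define q where "q y = (INF t\<in>{0..}. A y t)" for y
  have lower: "- p (- y) \<le> A y t" if "t \<ge> 0" for y t
  proof -
    have "t * p b = p ((y + t *\<^sub>R b) + (- y))" using sublinearD(2)[OF p that, of b] by simp
    also have "\<dots> \<le> p (y + t *\<^sub>R b) + p (- y)" by (rule sublinearD(1)[OF p])
    finally show ?thesis by (simp add: A_def)
  qed
  then have bdd: "bdd_below (A y ` {0..})" for y
    by (intro bdd_belowI2[of _ "- p (- y)"]) auto
  have up: "q y \<le> A y t" if "t \<ge> 0" for y t
    unfolding q_def using that bdd by (intro cINF_lower) auto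
  have least: "c \<le> q y" if "\<And>t. t \<ge> 0 \<Longrightarrow> c \<le> A y t" for c y
    unfolding q_def using that by (intro cINF_greatest) auto
  have le: "q y \<le> p y" for y using up[of 0 y] by (simp add: A_def)
  have q0: "q 0 = 0"
    using le[of 0] least[of "- p (- 0)" 0] lower[of _ 0] sublinearD(3)[OF p] by auto
  have add: "q (v + w) \<le> q v + q w" for v w
  proof -
    have "q (v + w) - A v s \<le> A w t" if "s \<ge> 0" "t \<ge> 0" for s t
    proof -
      have "q (v + w) \<le> A (v + w) (s + t)" using that by (intro up) simp
      also have "A (v + w) (s + t) = p ((v + s *\<^sub>R b) + (w + t *\<^sub>R b)) - (s + t) * p b"
        by (simp add: A_def algebra_simps)
      also have "\<dots> \<le> A v s + A w t"
        using sublinearD(1)[OF p, of "v + s *\<^sub>R b" "w + t *\<^sub>R b"] by (simp add: A_def algebra_simps)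
      finally show ?thesis by simp
    qed
    then have "q (v + w) - A v s \<le> q w" if "s \<ge> 0" for s using that least by blast
    then have "q (v + w) - q w \<le> A v s" if "s \<ge> 0" for s using that by (simp add: algebra_simps)
    then have "q (v + w) - q w \<le> q v" using least by blast
    then show ?thesis by simp
  qed
  have hom_le: "q (s *\<^sub>R y) \<le> s * q y" if "s > 0" for s y
  proof -
    have "q (s *\<^sub>R y) / s \<le> A y t" if t: "t \<ge> 0" for t
    proof -
      have "q (s *\<^sub>R y) \<le> A (s *\<^sub>R y) (s * t)" using \<open>s > 0\<close> t by (intro up) simp
      also have "\<dots> = s * A y t"
        using sublinearD(2)[OF p, of s "y + t *\<^sub>R b"] \<open>s > 0\<close> by (simp add: A_def algebra_simps)
      finally show ?thesis using \<open>s > 0\<close> by (simp add: field_simps)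
    qed
    then have "q (s *\<^sub>R y) / s \<le> q y" by (rule least)
    then show ?thesis using \<open>s > 0\<close> by (simp add: field_simps)
  qed
  have hom: "q (s *\<^sub>R y) = s * q y" if "s \<ge> 0" for s y
  proof (cases "s = 0")
    case False
    then have "s > 0" using that by simp
    then show ?thesis
      using hom_le[of s y] hom_le[of "1 / s" "s *\<^sub>R y"] by (simp add: field_simps)
  qed (simp add: q0)
  have "q (- b) \<le> - p b"
    using up[of 1 "- b"] sublinearD(3)[OF p] by (simp add: A_def)
  then show ?thesis
    using add hom le by (intro exI[of _ q]) (auto simp: sublinear_def)
qed

lemma sublinear_minorant_affine_on_finite:
  assumes "finite B" "sublinear (p :: 'a::real_vector \<Rightarrow> real)"
  shows "\<exists>q. sublinear q \<and> (\<forall>v. q v \<le> p v) \<and> (\<forall>b\<in>B. q (- b) \<le> - q b)"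
  using assms(1)
proof (induction B rule: finite_induct)
  case empty
  then show ?case using assms(2) by auto
next
  case (insert b B)
  then obtain q where q: "sublinear q" "\<And>v. q v \<le> p v" "\<And>b. b \<in> B \<Longrightarrow> q (- b) \<le> - q b" by blast
  obtain q' where q': "sublinear q'" "\<And>v. q' v \<le> q v" "q' (- b) \<le> - q b"
    using sublinear_minorant_affine_at[OF q(1), of b] by blast
  have "q' (- b) \<le> - q' b" using q'(2)[of b] q'(3) by linarith
  moreover have "q' (- a) \<le> - q' a" if "a \<in> B" for a
    using q'(2)[of a] q'(2)[of "- a"] q(3)[OF that] by linarith
  moreover have "q' v \<le> p v" for v using q(2)[of v] q'(2)[of v] by linarith
  ultimately show ?case using q'(1) by blast
qed

text \<open>The Hahn--Banach theorem in finite dimension. Starting from the norm, the minorant at \<open>x\<close> forces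
the value at \<open>x\<close>, and minorants at a complex spanning set \<open>B\<close> and at \<open>\<i> B\<close> make the functional real
linear; its complexification has the same norm.\<close>

theorem norming_functional:
  fixes x :: "'a::complex_normed_vector"
  assumes "complex_finite_dim TYPE('a)"
  obtains \<psi> :: "'a \<Rightarrow> complex" where "bounded_clinear \<psi>" "\<psi> x = of_real (norm x)"
    "\<And>y. cmod (\<psi> y) \<le> norm y"
proof -
  obtain B :: "'a set" where B: "finite B" "cvs.span B = UNIV"
    using assms by (auto simp: complex_finite_dim_def)
  have "sublinear (norm :: 'a \<Rightarrow> real)" by (simp add: sublinear_def norm_triangle_ineq)
  then obtain p where p: "sublinear p" "\<And>v. p v \<le> norm v" "p (- x) \<le> - norm x"
    using sublinear_minorant_affine_at[of norm x] by auto
  obtain q where q: "sublinear q" "\<And>v. q v \<le> p v"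
      "\<And>b. b \<in> B \<union> (\<lambda>b. \<i> *\<^sub>C b) ` B \<Longrightarrow> q (- b) \<le> - q b"
    using sublinear_minorant_affine_on_finite[OF _ p(1), of "B \<union> (\<lambda>b. \<i> *\<^sub>C b) ` B"] B(1) by auto
  define L where "L = {v. q (- v) = - q v}"
  have L_iff: "v \<in> L \<longleftrightarrow> q (- v) \<le> - q v" for v
    using sublinearD(4)[OF q(1), of v] by (auto simp: L_def)
  have L_add: "v + w \<in> L" if "v \<in> L" "w \<in> L" for v w
    using sublinearD(1)[OF q(1), of v w] sublinearD(1)[OF q(1), of "- v" "- w"] that
    by (simp add: L_iff)
  have L_scale: "t *\<^sub>R v \<in> L" if "v \<in> L" for t v
  proof (cases "t \<ge> 0")
    case True
    then show ?thesis
      using sublinearD(2)[OF q(1) True, of v] sublinearD(2)[OF q(1) True, of "- v"] that by (simp add: L_def)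
  next
    case False
    then have t: "- t \<ge> 0" by simp
    show ?thesis
      using sublinearD(2)[OF q(1) t, of v] sublinearD(2)[OF q(1) t, of "- v"] that by (simp add: L_def)
  qed
  define W where "W = {v. v \<in> L \<and> \<i> *\<^sub>C v \<in> L}"
  have c_eq: "c *\<^sub>C v = Re c *\<^sub>R v + Im c *\<^sub>R (\<i> *\<^sub>C v)" for c and v :: 'a
    unfolding scaleR_scaleC scaleC_scaleC scaleC_add_left[symmetric]
    by (rule arg_cong[where f = "\<lambda>c. c *\<^sub>C v"]) (simp add: complex_eq_iff)
  have ic_eq: "\<i> *\<^sub>C (c *\<^sub>C v) = Re c *\<^sub>R (\<i> *\<^sub>C v) + (- Im c) *\<^sub>R v" for c and v :: 'a
    unfolding scaleR_scaleC scaleC_scaleC scaleC_add_left[symmetric]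
    by (rule arg_cong[where f = "\<lambda>c. c *\<^sub>C v"]) (simp add: complex_eq_iff)
  have "cvs.subspace W"
    unfolding cvs.subspace_def
  proof (intro conjI ballI allI)
    show "0 \<in> W" using L_scale[of _ 0] sublinearD(3)[OF q(1)] by (simp add: W_def L_iff)
    show "v + w \<in> W" if "v \<in> W" "w \<in> W" for v w
      using that L_add by (simp add: W_def scaleC_add_right)
    show "c *\<^sub>C v \<in> W" if "v \<in> W" for c v
    proof -
      have v: "v \<in> L" "\<i> *\<^sub>C v \<in> L" using that by (simp_all add: W_def)
      have "c *\<^sub>C v \<in> L" by (subst c_eq) (intro L_add L_scale v)
      moreover have "\<i> *\<^sub>C (c *\<^sub>C v) \<in> L" by (subst ic_eq) (intro L_add L_scale v)
      ultimately show ?thesis by (simp only: W_def mem_Collect_eq simp_thms)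
    qed
  qed
  moreover have "B \<subseteq> W" using q(3) by (auto simp: W_def L_iff)
  ultimately have "cvs.span B \<subseteq> W" by (rule cvs.span_minimal[rotated])
  then have L: "v \<in> L" for v using B(2) by (auto simp: W_def)
  then have q_minus: "q (- v) = - q v" for v by (simp add: L_def)
  have q_add: "q (v + w) = q v + q w" for v w
    using sublinearD(1)[OF q(1), of v w] sublinearD(1)[OF q(1), of "- v" "- w"] q_minus[of "v + w"]
    by (simp add: q_minus)
  have q_scale: "q (t *\<^sub>R v) = t * q v" for t v
    using sublinearD(2)[OF q(1), of t v] sublinearD(2)[OF q(1), of "- t" v] q_minus[of "t *\<^sub>R v"]
    by (cases "t \<ge> 0") auto
  define \<psi> where "\<psi> y = Complex (q y) (- q (\<i> *\<^sub>C y))" for y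
  have l_add: "\<psi> (v + w) = \<psi> v + \<psi> w" for v w
    by (simp add: \<psi>_def scaleC_add_right q_add complex_eq_iff)
  have l_scale: "\<psi> (c *\<^sub>C v) = c *\<^sub>C \<psi> v" for c v
  proof -
    have "q (c *\<^sub>C v) = Re c * q v + Im c * q (\<i> *\<^sub>C v)"
      by (subst c_eq) (simp only: q_add q_scale)
    moreover have "q (\<i> *\<^sub>C (c *\<^sub>C v)) = Re c * q (\<i> *\<^sub>C v) + (- Im c) * q v"
      by (subst ic_eq) (simp only: q_add q_scale)
    ultimately show ?thesis
      unfolding \<psi>_def by (simp add: complex_eq_iff scaleC_complex_def del: cvs.scale_scale)
  qed
  have l_le: "cmod (\<psi> y) \<le> norm y" for y
  proof (cases "\<psi> y = 0")
    case False
    define \<alpha> where "\<alpha> = cnj (\<psi> y) / of_real (cmod (\<psi> y))"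
    have "cnj (\<psi> y) * \<psi> y = (of_real (cmod (\<psi> y)))\<^sup>2"
      using complex_norm_square[of "\<psi> y"] by (simp add: mult.commute)
    then have "\<psi> (\<alpha> *\<^sub>C y) = of_real (cmod (\<psi> y))"
      using False by (simp add: l_scale scaleC_complex_def \<alpha>_def power2_eq_square)
    then have "q (\<alpha> *\<^sub>C y) = cmod (\<psi> y)" by (simp add: \<psi>_def complex_eq_iff)
    then have "cmod (\<psi> y) \<le> norm (\<alpha> *\<^sub>C y)" using q(2)[of "\<alpha> *\<^sub>C y"] p(2)[of "\<alpha> *\<^sub>C y"] by linarith
    also have "\<dots> = norm y" using False by (simp add: norm_scaleC \<alpha>_def norm_divide)
    finally show ?thesis .
  qed simp
  show ?thesis
  proof
    have "bounded_linear \<psi>"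
      by (rule bounded_linear_intro[where K = 1])
         (auto simp: l_add l_le scaleR_scaleC l_scale scaleC_complex_def)
    then show "bounded_clinear \<psi>" by (simp add: bounded_clinear_def clinear_iff l_add l_scale)
    have "norm x \<le> q x" using q(2)[of "- x"] p(3) by (simp add: q_minus)
    then have "q x = norm x" using q(2)[of x] p(2)[of x] by simp
    moreover have "(cmod (\<psi> x))\<^sup>2 \<le> (norm x)\<^sup>2" using l_le[of x] by (simp add: power_mono)
    ultimately show "\<psi> x = of_real (norm x)"
      by (simp add: \<psi>_def complex_eq_iff cmod_power2)
    show "cmod (\<psi> y) \<le> norm y" for y by (rule l_le)
  qed
qed

lemma norm_le_by_functionals:
  fixes v :: "'a::complex_normed_vector"
  assumes "complex_finite_dim TYPE('a)"
    and "\<And>\<psi>. bounded_clinear \<psi> \<Longrightarrow> (\<And>y. cmod (\<psi> y) \<le> norm y) \<Longrightarrow> cmod (\<psi> v) \<le> K"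
  shows "norm v \<le> K"
proof -
  obtain \<psi> where "bounded_clinear \<psi>" "\<psi> v = of_real (norm v)" "\<And>y. cmod (\<psi> y) \<le> norm y"
    by (rule norming_functional[OF assms(1), of v]) (rule that)
  then show ?thesis using assms(2)[of \<psi>] by simp
qed

lemma eq_by_functionals:
  fixes v w :: "'a::complex_normed_vector"
  assumes "complex_finite_dim TYPE('a)"
    and "\<And>\<psi> :: 'a \<Rightarrow> complex. bounded_clinear \<psi> \<Longrightarrow> \<psi> v = \<psi> w"
  shows "v = w"
proof -
  have "norm (v - w) \<le> 0"
  proof (rule norm_le_by_functionals[OF assms(1)])
    fix \<psi> :: "'a \<Rightarrow> complex" assume "bounded_clinear \<psi>"
    then show "cmod (\<psi> (v - w)) \<le> 0"
      using assms(2)[of \<psi>] by (simp add: clinear_diff bounded_clinear_imp_clinear)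
  qed
  then show ?thesis by simp
qed

section \<open>Holomorphic maps and the Caratheodory distance from the centre\<close>

lemma holomorphic_map_along_line:
  fixes \<phi> :: "'a::complex_normed_vector \<Rightarrow> 'b::complex_normed_vector" and \<psi> :: "'b \<Rightarrow> complex"
  assumes \<phi>: "(\<phi> has_derivative T) (at (a + z *\<^sub>C b))" "bounded_clinear T" and \<psi>: "bounded_clinear \<psi>"
  shows "((\<lambda>\<zeta>. \<psi> (\<phi> (a + \<zeta> *\<^sub>C b))) has_field_derivative \<psi> (T b)) (at z)"
proof -
  have "((\<lambda>\<zeta>. a + \<zeta> *\<^sub>C b) has_derivative (\<lambda>h. h *\<^sub>C b)) (at z)"
    using bounded_linear_imp_has_derivative[OF bounded_linear_scaleC_left[of b], of "at z"]
    by (auto intro!: derivative_eq_intros)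
  then have "((\<lambda>\<zeta>. \<phi> (a + \<zeta> *\<^sub>C b)) has_derivative (\<lambda>h. T (h *\<^sub>C b))) (at z)"
    by (rule has_derivative_compose) (rule \<phi>(1))
  then have "((\<lambda>\<zeta>. \<psi> (\<phi> (a + \<zeta> *\<^sub>C b))) has_derivative (\<lambda>h. \<psi> (T (h *\<^sub>C b)))) (at z)"
    by (rule bounded_linear.has_derivative[OF bounded_clinear_imp_bounded_linear[OF \<psi>]])
  moreover have "\<psi> (T (h *\<^sub>C b)) = \<psi> (T b) * h" for h
    using \<phi>(2) \<psi> by (simp add: bounded_clinear_imp_clinear clinear_scaleC scaleC_complex_def mult.commute)
  ultimately show ?thesis by (simp add: has_field_derivative_def)
qed

lemma holomorphic_map_ballD:
  assumes "holomorphic_map \<phi> (ball 0 1)" "norm x < 1"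
  obtains T where "bounded_clinear T" "(\<phi> has_derivative T) (at x)"
proof -
  have "x \<in> ball 0 1" using assms(2) by simp
  then obtain T where "bounded_clinear T" "(\<phi> has_derivative T) (at x within ball 0 1)"
    using assms(1) unfolding holomorphic_map_def by metis
  then show ?thesis using that at_within_open[OF \<open>x \<in> ball 0 1\<close>] by simp
qed

lemma holomorphic_on_line:
  fixes \<phi> :: "'a::complex_normed_vector \<Rightarrow> 'b::complex_normed_vector" and \<psi> :: "'b \<Rightarrow> complex"
  assumes "holomorphic_map \<phi> (ball 0 1)" "bounded_clinear \<psi>" and S: "\<And>\<zeta>. \<zeta> \<in> S \<Longrightarrow> norm (a + \<zeta> *\<^sub>C b) < 1"
  shows "(\<lambda>\<zeta>. \<psi> (\<phi> (a + \<zeta> *\<^sub>C b))) holomorphic_on S"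
proof (rule holomorphic_onI)
  fix z assume "z \<in> S"
  obtain T where "bounded_clinear T" "(\<phi> has_derivative T) (at (a + z *\<^sub>C b))"
    by (rule holomorphic_map_ballD[OF assms(1) S[OF \<open>z \<in> S\<close>]])
  then have "((\<lambda>\<zeta>. \<psi> (\<phi> (a + \<zeta> *\<^sub>C b))) has_field_derivative \<psi> (T b)) (at z)"
    by (intro holomorphic_map_along_line assms(2))
  then show "(\<lambda>\<zeta>. \<psi> (\<phi> (a + \<zeta> *\<^sub>C b))) field_differentiable at z within S"
    by (meson field_differentiable_at_within field_differentiable_def)
qed

lemma artanh_real_less:
  assumes "0 \<le> a" "a < b" "b < (1::real)"
  shows "artanh a < artanh b"
proof -
  have "(1 + a) / (1 - a) < (1 + b) / (1 - b)" using assms by (simp add: field_simps)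
  then show ?thesis using assms by (simp add: artanh_def)
qed

text \<open>The Schwarz--Pick lemma for the restriction of \<open>f\<close> to the disc through \<open>x\<close>; a Moebius
transformation moves \<open>f 0\<close> to the origin.\<close>

lemma poincare_dist_le:
  assumes f: "holomorphic_map f (ball (0::'a::complex_normed_vector) 1)" "f ` ball 0 1 \<subseteq> ball 0 1"
    and x: "norm x < 1"
  shows "poincare_dist (f 0) (f x) \<le> artanh (norm x)"
proof (cases "x = 0")
  case True
  then show ?thesis by (simp add: poincare_dist_def)
next
  case False
  define e where "e = x /\<^sub>R norm x"
  have e: "norm e = 1" "of_real (norm x) *\<^sub>C e = x"
    using False by (simp_all add: e_def scaleC_of_real)
  define F where "F \<zeta> = f (0 + \<zeta> *\<^sub>C e)" for \<zeta>
  have id: "bounded_clinear (\<lambda>z::complex. z)"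
    by (simp add: bounded_clinear_def clinear_iff bounded_linear_ident)
  have holF: "F holomorphic_on ball 0 1"
    unfolding F_def by (rule holomorphic_on_line[OF f(1) id]) (simp add: norm_scaleC e)
  have F1: "cmod (F \<zeta>) < 1" if "cmod \<zeta> < 1" for \<zeta>
  proof -
    have "0 + \<zeta> *\<^sub>C e \<in> ball 0 1" using that by (simp add: norm_scaleC e)
    then show ?thesis using f(2) unfolding F_def by (metis image_subset_iff mem_ball_0)
  qed
  define w where "w = F 0"
  have w: "cmod w < 1" by (simp add: w_def F1)
  define G where "G = Moebius_function 0 w \<circ> F"
  have holG: "G holomorphic_on ball 0 1"
    unfolding G_def
    by (rule holomorphic_on_compose_gen[OF holF Moebius_function_holomorphic[OF w]]) (auto simp: F1)
  have "cmod (G (of_real (norm x))) \<le> cmod (of_real (norm x))"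
  proof (rule Schwarz_Lemma(1)[OF holG])
    show "G 0 = 0" by (simp add: G_def w_def Moebius_function_eq_zero)
    show "cmod (G z) < 1" if "cmod z < 1" for z
      using Moebius_function_norm_lt_1[OF w F1[OF that]] by (simp add: G_def)
  qed (simp add: x)
  moreover have "F (of_real (norm x)) = f x" "w = f 0" using e by (simp_all add: F_def w_def)
  moreover have "cmod (1 - cnj (f 0) * f x) = cmod (1 - f 0 * cnj (f x))"
    by (metis complex_cnj_cnj complex_cnj_diff complex_cnj_mult complex_cnj_one complex_mod_cnj)
  ultimately have "cmod ((f 0 - f x) / (1 - f 0 * cnj (f x))) \<le> norm x"
    by (simp add: G_def Moebius_function_simple norm_divide norm_minus_commute)
  then show ?thesis
    unfolding poincare_dist_def using artanh_real_less x
    by (metis norm_ge_zero order.order_iff_strict)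
qed

text \<open>A norming functional of \<open>x\<close> attains the bound given by the Schwarz--Pick lemma.\<close>

lemma caratheodory_dist_centre:
  fixes x :: "'a::complex_normed_vector"
  assumes "complex_finite_dim TYPE('a)" and x: "norm x < 1"
  shows "caratheodory_dist (ball 0 1) 0 x = artanh (norm x)"
proof -
  let ?H = "{f :: 'a \<Rightarrow> complex. holomorphic_map f (ball 0 1) \<and> f ` ball 0 1 \<subseteq> ball 0 1}"
  obtain \<psi> where \<psi>: "bounded_clinear \<psi>" "\<psi> x = of_real (norm x)" "\<And>y. cmod (\<psi> y) \<le> norm y"
    by (rule norming_functional[OF assms(1), of x]) (rule that)
  have "holomorphic_map \<psi> (ball 0 1)"
    unfolding holomorphic_map_def using \<psi>(1) bounded_clinear_imp_bounded_linear bounded_linear_imp_has_derivative by blast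
  moreover have "\<psi> ` ball 0 1 \<subseteq> ball 0 1"
    by (auto simp: image_subset_iff intro: le_less_trans[OF \<psi>(3)])
  ultimately have mem: "\<psi> \<in> ?H" by simp
  have le: "poincare_dist (f 0) (f x) \<le> artanh (norm x)" if "f \<in> ?H" for f
    using poincare_dist_le[of f x] that x by auto
  have val: "poincare_dist (\<psi> 0) (\<psi> x) = artanh (norm x)"
    using \<psi>(2) clinear_0[OF bounded_clinear_imp_clinear[OF \<psi>(1)]] by (simp add: poincare_dist_def)
  show ?thesis
    unfolding caratheodory_dist_def
  proof (rule antisym)
    show "(SUP f\<in>?H. poincare_dist (f 0) (f x)) \<le> artanh (norm x)"
      using mem le by (intro cSUP_least) auto
    show "artanh (norm x) \<le> (SUP f\<in>?H. poincare_dist (f 0) (f x))"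
      unfolding val[symmetric]
      by (rule cSUP_upper[OF mem]) (rule bdd_aboveI2[of _ _ "artanh (norm x)"], rule le)
  qed
qed

section \<open>Extreme points and the Schwarz lemma\<close>

text \<open>A Borel--Caratheodory estimate. After a rotation \<open>\<alpha> g 0\<close> is real and non-negative, and
\<open>k = \<alpha> (g - g 0)\<close> has real part below \<open>A = 1 - cmod (g 0) + \<epsilon> / 2\<close>. The Moebius map
\<open>k \<mapsto> k / (2 A - k)\<close> carries this half plane into the disc and fixes the origin, so the Schwarz
lemma bounds \<open>k\<close>. The summand \<open>\<epsilon> / 2\<close> keeps \<open>A\<close> positive and the inequalities strict.\<close>

lemma disc_oscillation_le:
  assumes g: "g holomorphic_on ball 0 1" and g1: "\<And>z. cmod z < 1 \<Longrightarrow> cmod (g z) \<le> 1" and \<zeta>: "cmod \<zeta> < 1"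
  shows "cmod (g \<zeta> - g 0) * (1 - cmod \<zeta>) \<le> 2 * cmod \<zeta> * (1 - cmod (g 0))"
proof -
  define \<alpha> where "\<alpha> = (if g 0 = 0 then 1 else cnj (g 0) / of_real (cmod (g 0)))"
  have \<alpha>: "cmod \<alpha> = 1" "\<alpha> * g 0 = of_real (cmod (g 0))"
  proof -
    have "cnj (g 0) * g 0 = of_real (cmod (g 0)) * of_real (cmod (g 0))"
      using complex_norm_square[of "g 0"] by (simp add: power2_eq_square mult.commute)
    then show "cmod \<alpha> = 1" "\<alpha> * g 0 = of_real (cmod (g 0))"
      by (auto simp: \<alpha>_def norm_divide)
  qed
  define k where "k z = \<alpha> * (g z - g 0)" for z
  have "cmod (k \<zeta>) * (1 - cmod \<zeta>) \<le> 2 * cmod \<zeta> * (1 - cmod (g 0)) + \<epsilon>" if "\<epsilon> > 0" for \<epsilon>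
  proof -
    define A where "A = 1 - cmod (g 0) + \<epsilon> / 2"
    have "A > 0" using g1[of 0] that by (simp add: A_def)
    have Re: "Re (k z) < A" if z: "cmod z < 1" for z
    proof -
      have "Re (\<alpha> * g z) \<le> cmod (\<alpha> * g z)" by (rule complex_Re_le_cmod)
      also have "\<dots> \<le> 1" using g1[OF z] by (simp add: norm_mult \<alpha>)
      finally show ?thesis using \<open>\<epsilon> > 0\<close> by (simp add: k_def right_diff_distrib \<alpha>(2) A_def)
    qed
    have nz: "2 * of_real A - k z \<noteq> 0" if "cmod z < 1" for z
      using Re[OF that] \<open>A > 0\<close> by (auto simp: complex_eq_iff)
    define w where "w z = k z / (2 * of_real A - k z)" for z
    have "w holomorphic_on ball 0 1"
      unfolding w_def k_def by (intro holomorphic_intros g) (use nz in \<open>auto simp: k_def\<close>)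
    moreover have "w 0 = 0" by (simp add: w_def k_def)
    moreover have "cmod (w z) < 1" if "cmod z < 1" for z
    proof -
      have "(cmod (k z))\<^sup>2 < (cmod (2 * of_real A - k z))\<^sup>2"
        using mult_strict_left_mono[OF Re[OF that] \<open>A > 0\<close>]
        unfolding cmod_power2 by (simp add: power2_eq_square algebra_simps)
      then have "cmod (k z) < cmod (2 * of_real A - k z)" by (simp add: power2_less_imp_less)
      then show ?thesis using nz[OF that] by (simp add: w_def norm_divide)
    qed
    ultimately have "cmod (w \<zeta>) \<le> cmod \<zeta>" using Schwarz_Lemma(1) \<zeta> by blast
    then have "cmod (k \<zeta>) \<le> cmod \<zeta> * cmod (2 * of_real A - k \<zeta>)"
      using nz[OF \<zeta>] by (simp add: w_def norm_divide field_simps)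
    also have "\<dots> \<le> cmod \<zeta> * (2 * A + cmod (k \<zeta>))"
      using norm_triangle_ineq4[of "2 * of_real A" "k \<zeta>"] \<open>A > 0\<close> by (intro mult_left_mono) (auto simp: norm_mult)
    finally have "cmod (k \<zeta>) * (1 - cmod \<zeta>) \<le> 2 * cmod \<zeta> * A" by (simp add: algebra_simps)
    also have "\<dots> \<le> 2 * cmod \<zeta> * (1 - cmod (g 0)) + \<epsilon>"
      using \<zeta> \<open>\<epsilon> > 0\<close> by (simp add: A_def algebra_simps)
    finally show ?thesis .
  qed
  then have "cmod (k \<zeta>) * (1 - cmod \<zeta>) \<le> 2 * cmod \<zeta> * (1 - cmod (g 0))" by (rule field_le_epsilon)
  then show ?thesis by (simp add: k_def norm_mult \<alpha>)
qed

text \<open>Along the disc through \<open>e\<close>, the function \<open>\<phi> (\<zeta> e) / \<zeta>\<close> maps into the closed unit ball and equals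
\<open>T e\<close> at the origin. The oscillation estimate, applied to all functionals of norm at most one, shows
that a positive multiple \<open>a\<close> of its deviation from \<open>T e\<close> spans a disc about \<open>T e\<close> in the unit
ball; extremality of \<open>T e\<close> forces \<open>a = 0\<close>.\<close>

theorem schwarz_equality_at_extreme_point:
  fixes \<phi> :: "'a::complex_normed_vector \<Rightarrow> 'b::complex_normed_vector"
  assumes fd: "complex_finite_dim TYPE('b)" and hol: "holomorphic_map \<phi> (ball 0 1)"
    and le: "\<And>x. norm x < 1 \<Longrightarrow> norm (\<phi> x) \<le> norm x"
    and T: "bounded_clinear T" "(\<phi> has_derivative T) (at 0)"
    and e: "norm e \<le> 1" "norm (T e) \<le> 1"
    and extreme: "\<And>a. (\<And>\<mu>. cmod \<mu> = 1 \<Longrightarrow> norm (T e + \<mu> *\<^sub>C a) \<le> 1) \<Longrightarrow> a = 0"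
    and \<zeta>: "cmod \<zeta> < 1"
  shows "\<phi> (\<zeta> *\<^sub>C e) = \<zeta> *\<^sub>C T e"
proof (cases "\<zeta> = 0")
  case True
  then show ?thesis using le[of 0] by simp
next
  case False
  have ze: "norm (z *\<^sub>C e) < 1" if "cmod z < 1" for z
    using e(1) that by (simp add: norm_scaleC) (meson le_less_trans mult_left_le norm_ge_zero)
  \<comment> \<open>the constant of \<open>disc_oscillation_le\<close>\<close>
  define c where "c = (1 - cmod \<zeta>) / (2 * cmod \<zeta>)"
  have "c > 0" using False \<zeta> by (simp add: c_def)
  define a where "a = c *\<^sub>R ((1 / \<zeta>) *\<^sub>C \<phi> (\<zeta> *\<^sub>C e) - T e)"
  have "a = 0"
  proof (rule extreme)
    fix \<mu> assume \<mu>: "cmod \<mu> = 1"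
    show "norm (T e + \<mu> *\<^sub>C a) \<le> 1"
    proof (rule norm_le_by_functionals[OF fd])
      fix \<psi> :: "'b \<Rightarrow> complex" assume \<psi>: "bounded_clinear \<psi>" "\<And>y. cmod (\<psi> y) \<le> norm y"
      note lin = bounded_clinear_imp_clinear[OF \<psi>(1)]
      define h where "h z = \<psi> (\<phi> (0 + z *\<^sub>C e))" for z
      have "h holomorphic_on ball 0 1"
        unfolding h_def by (rule holomorphic_on_line[OF hol \<psi>(1)]) (simp add: ze)
      moreover have "h 0 = 0" using le[of 0] by (simp add: h_def clinear_0[OF lin])
      ultimately obtain g where g: "g holomorphic_on ball 0 1" "\<And>z. cmod z < 1 \<Longrightarrow> h z = z * g z"
        "deriv h 0 = g 0" using Schwarz3 by blast
      have "(h has_field_derivative \<psi> (T e)) (at 0)"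
        unfolding h_def by (rule holomorphic_map_along_line) (use T \<psi> in auto)
      then have g0: "g 0 = \<psi> (T e)" using g(3) by (simp add: DERIV_imp_deriv)
      have g1: "cmod (g z) \<le> 1" if z: "cmod z < 1" for z
      proof (cases "z = 0")
        case True
        then show ?thesis using \<psi>(2)[of "T e"] e(2) by (simp add: g0)
      next
        case z0: False
        have "cmod z * cmod (g z) = cmod (h z)" by (simp add: g(2)[OF z] norm_mult)
        also have "\<dots> \<le> norm (\<phi> (z *\<^sub>C e))" using \<psi>(2) by (simp add: h_def)
        also have "\<dots> \<le> norm (z *\<^sub>C e)" by (rule le[OF ze[OF z]])
        also have "\<dots> \<le> cmod z * 1" using e(1) by (simp add: norm_scaleC mult_left_le)
        finally show ?thesis using z0 by simp
      qed
      have "\<psi> a = of_real c * (g \<zeta> - g 0)"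
        using g(2)[OF \<zeta>] False
        by (simp add: a_def scaleR_scaleC clinear_simps[OF lin] scaleC_complex_def h_def g0)
      then have "\<psi> (T e + \<mu> *\<^sub>C a) = g 0 + \<mu> * (of_real c * (g \<zeta> - g 0))"
        by (simp add: clinear_simps[OF lin] scaleC_complex_def g0)
      then have "cmod (\<psi> (T e + \<mu> *\<^sub>C a)) \<le> cmod (g 0) + c * cmod (g \<zeta> - g 0)"
        using norm_triangle_ineq[of "g 0" "\<mu> * (of_real c * (g \<zeta> - g 0))"] \<mu> \<open>c > 0\<close> by (simp add: norm_mult)
      also have "c * cmod (g \<zeta> - g 0) \<le> 1 - cmod (g 0)"
        using disc_oscillation_le[OF g(1) g1 \<zeta>] False by (simp add: c_def field_simps)
      finally show "cmod (\<psi> (T e + \<mu> *\<^sub>C a)) \<le> 1" by simp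
    qed
  qed
  then have "(1 / \<zeta>) *\<^sub>C \<phi> (\<zeta> *\<^sub>C e) = T e" using \<open>c > 0\<close> by (simp add: a_def)
  then have "\<zeta> *\<^sub>C ((1 / \<zeta>) *\<^sub>C \<phi> (\<zeta> *\<^sub>C e)) = \<zeta> *\<^sub>C T e" by simp
  then show ?thesis using False by simp
qed

context jb_triple
begin

section \<open>Polarization and semicontinuity of the spectrum\<close>

lemma triple_polarization:
  "4 *\<^sub>R triple a b z = triple (a + b) (a + b) z + \<i> *\<^sub>C triple (a + \<i> *\<^sub>C b) (a + \<i> *\<^sub>C b) z
    + (- triple (a - b) (a - b) z) + (- (\<i> *\<^sub>C triple (a - \<i> *\<^sub>C b) (a - \<i> *\<^sub>C b) z))"
  by (simp add: triple_linear scaleR_4 scaleC_add_right cvs.scale_right_diff_distrib algebra_simps)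

lemma cube_polarization:
  "triple (x + z) (x + z) (x + z) + triple (x + \<i> *\<^sub>C z) (x + \<i> *\<^sub>C z) (x + \<i> *\<^sub>C z)
    + triple (x - z) (x - z) (x - z) + triple (x - \<i> *\<^sub>C z) (x - \<i> *\<^sub>C z) (x - \<i> *\<^sub>C z)
    = 4 *\<^sub>R triple x x x + 4 *\<^sub>R (2 *\<^sub>R triple z z x)"
  by (simp add: triple_linear scaleR_4 scaleR_2 scaleC_add_right cvs.scale_right_diff_distrib
      triple_commute[of x z z] triple_commute[of z x x] algebra_simps)

lemma cube_line:
  "triple (x + t *\<^sub>R y) (x + t *\<^sub>R y) (x + t *\<^sub>R y)
    = triple x x x + t *\<^sub>R (triple y x x + triple x y x + triple x x y)
      + t\<^sup>2 *\<^sub>R (triple y y x + triple y x y + triple x y y) + t ^ 3 *\<^sub>R triple y y y"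
  by (simp add: triple_linear triple_scaleR power2_eq_square power3_eq_cube scaleR_add_right algebra_simps)

lemma norm_triple_le: "norm (triple a b z) \<le> 4 * norm a * norm b * norm z"
proof -
  have bound: "norm (triple a b z) \<le> (norm a + norm b)\<^sup>2 * norm z" for a b z
  proof -
    have T: "norm (triple c c z) \<le> (norm a + norm b)\<^sup>2 * norm z" if "norm c \<le> norm a + norm b" for c
      using norm_box_le[of c z] mult_right_mono[OF power_mono[OF that norm_ge_zero, of 2], of "norm z"] by simp
    have n: "norm (a + b) \<le> norm a + norm b" "norm (a + \<i> *\<^sub>C b) \<le> norm a + norm b"
      "norm (a - b) \<le> norm a + norm b" "norm (a - \<i> *\<^sub>C b) \<le> norm a + norm b"
      using norm_triangle_ineq[of a b] norm_triangle_ineq[of a "\<i> *\<^sub>C b"]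
        norm_triangle_ineq4[of a b] norm_triangle_ineq4[of a "\<i> *\<^sub>C b"] by (simp_all add: norm_scaleC)
    have "4 * norm (triple a b z) = norm (4 *\<^sub>R triple a b z)" by simp
    also have "\<dots> \<le> (norm a + norm b)\<^sup>2 * norm z + (norm a + norm b)\<^sup>2 * norm z
        + (norm a + norm b)\<^sup>2 * norm z + (norm a + norm b)\<^sup>2 * norm z"
      unfolding triple_polarization
      by (intro norm_triangle_mono) (simp_all add: norm_scaleC T n)
    finally show ?thesis by (simp add: mult.commute)
  qed
  show ?thesis
  proof (cases "a = 0 \<or> b = 0")
    case False
    define a' b' where "a' = a /\<^sub>R norm a" and "b' = b /\<^sub>R norm b"
    have ab: "norm a' = 1" "norm b' = 1" "a = norm a *\<^sub>R a'" "b = norm b *\<^sub>R b'"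
      using False by (auto simp: a'_def b'_def)
    have "triple a b z = norm a *\<^sub>R norm b *\<^sub>R triple a' b' z"
      by (subst ab(3), subst ab(4)) (simp add: triple_scaleR mult.commute)
    then have "norm (triple a b z) = norm a * norm b * norm (triple a' b' z)" by simp
    also have "\<dots> \<le> norm a * norm b * (4 * norm z)"
      using bound[of a' b' z] by (intro mult_left_mono) (auto simp: ab(1,2))
    finally show ?thesis by (simp add: mult_ac)
  qed auto
qed

lemma tendsto_box:
  assumes "(f \<longlongrightarrow> l) (at x0)"
  shows "((\<lambda>x. triple x x (f x)) \<longlongrightarrow> triple x0 x0 l) (at x0)"
proof -
  have eq: "triple x x (f x) - triple x0 x0 l
      = triple (x - x0) x (f x) + triple x0 (x - x0) (f x) + triple x0 x0 (f x - l)" for x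
    by (simp add: triple_linear)
  have "((\<lambda>x. 4 * norm (x - x0) * norm x * norm (f x) + 4 * norm x0 * norm (x - x0) * norm (f x)
      + 4 * norm x0 * norm x0 * norm (f x - l)) \<longlongrightarrow>
      4 * norm (x0 - x0) * norm x0 * norm l + 4 * norm x0 * norm (x0 - x0) * norm l
      + 4 * norm x0 * norm x0 * norm (l - l)) (at x0)"
    by (intro tendsto_intros assms)
  then have "((\<lambda>x. 4 * norm (x - x0) * norm x * norm (f x) + 4 * norm x0 * norm (x - x0) * norm (f x)
      + 4 * norm x0 * norm x0 * norm (f x - l)) \<longlongrightarrow> 0) (at x0)" by simp
  then have "((\<lambda>x. triple x x (f x) - triple x0 x0 l) \<longlongrightarrow> 0) (at x0)"
  proof (rule Lim_null_comparison[rotated])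
    show "\<forall>\<^sub>F x in at x0. norm (triple x x (f x) - triple x0 x0 l)
      \<le> 4 * norm (x - x0) * norm x * norm (f x) + 4 * norm x0 * norm (x - x0) * norm (f x)
      + 4 * norm x0 * norm x0 * norm (f x - l)"
      unfolding eq by (intro always_eventually allI norm_triangle_mono norm_triple_le)
  qed
  then show ?thesis by (simp add: LIM_zero_iff)
qed

lemma isCont_odd_pow: "isCont (\<lambda>x. odd_pow x n) x0"
proof (induction n)
  case (Suc n)
  then show ?case
    unfolding isCont_def odd_pow_Suc by (rule tendsto_box)
qed simp

text \<open>A fixed linear combination of odd powers depends continuously on the element.\<close>

lemma odd_span_continuous_selection:
  assumes "v \<in> odd_span x0"
  shows "\<exists>F. isCont F x0 \<and> F x0 = v \<and> (\<forall>x. F x \<in> odd_span x)"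
  using assms
proof (induction rule: cvs.span_induct_alt)
  case base
  show ?case by (rule exI[of _ "\<lambda>_. 0"]) (simp add: cvs.span_zero)
next
  case (step c a y)
  then obtain n F where n: "a = odd_pow x0 n" and F: "isCont F x0" "F x0 = y" "\<And>x. F x \<in> odd_span x"
    by auto
  have "isCont (\<lambda>x. c *\<^sub>C odd_pow x n + F x) x0"
    by (intro isCont_add F bounded_linear.isCont[OF bounded_linear_scaleC_right] isCont_odd_pow)
  moreover have "c *\<^sub>C odd_pow x n + F x \<in> odd_span x" for x
    by (intro cvs.span_add cvs.span_scale F cvs.span_base) simp
  ultimately show ?case using n F(2) by (intro exI[of _ "\<lambda>x. c *\<^sub>C odd_pow x n + F x"]) simp
qed

lemma odd_span_least:
  assumes "cvs.subspace W" "\<And>y. y \<in> W \<Longrightarrow> triple x x y \<in> W" "x \<in> W"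
  shows "odd_span x \<subseteq> W"
  unfolding odd_span_eq_orbit_span by (rule orbit_span_least) (use assms in auto)

lemma odd_span_subset_frame_span:
  assumes "finite S" "orth_family S f"
  shows "odd_span (\<Sum>s\<in>S. s *\<^sub>R f s) \<subseteq> cvs.span (f ` S)"
proof (rule odd_span_least)
  let ?x = "\<Sum>s\<in>S. s *\<^sub>R f s"
  have base: "f s \<in> cvs.span (f ` S)" if "s \<in> S" for s using that by (simp add: cvs.span_base)
  show "?x \<in> cvs.span (f ` S)"
    unfolding scaleR_scaleC by (intro cvs.span_sum cvs.span_scale base)
  show "triple ?x ?x y \<in> cvs.span (f ` S)" if "y \<in> cvs.span (f ` S)" for y
    using that
  proof (induction rule: cvs.span_induct_alt)
    case (step c a y)
    then obtain s where "s \<in> S" "a = f s" by auto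
    then have "triple ?x ?x a = s\<^sup>2 *\<^sub>R a"
      using box_orth_sum_eigen[OF assms, of s "\<lambda>s. of_real s"] by (simp add: scaleR_scaleC)
    then have "triple ?x ?x a \<in> cvs.span (f ` S)"
      using step.hyps by (simp add: scaleR_scaleC cvs.span_base cvs.span_scale)
    then show ?case by (simp add: triple_add_right triple_scaleC_right cvs.span_add cvs.span_scale step.IH)
  qed (simp add: cvs.span_zero)
qed simp

text \<open>Distinct positive coefficients make the tripotents recoverable from the odd powers of the sum,
since they belong to distinct eigenvalues of its box operator.\<close>

lemma frame_in_odd_span:
  assumes "finite I" "orth_family I e" "inj_on c I" "\<And>i. i \<in> I \<Longrightarrow> c i > (0::real)" "i \<in> I"
  shows "e i \<in> odd_span (\<Sum>i\<in>I. c i *\<^sub>R e i)"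
proof -
  let ?x = "\<Sum>i\<in>I. c i *\<^sub>R e i"
  have "\<forall>i\<in>I. c i *\<^sub>R e i \<in> odd_span ?x"
  proof (rule invariant_subspace_contains_eigen_components[OF clinear_triple[of ?x ?x]])
    show "triple ?x ?x y \<in> odd_span ?x" if "y \<in> odd_span ?x" for y
      using that orbit_span_invariant[OF clinear_triple] unfolding odd_span_eq_orbit_span by blast
    show "inj_on (\<lambda>i. complex_of_real ((c i)\<^sup>2)) I"
    proof (rule inj_onI)
      fix i j assume ij: "i \<in> I" "j \<in> I" "complex_of_real ((c i)\<^sup>2) = of_real ((c j)\<^sup>2)"
      then have "(c i)\<^sup>2 = (c j)\<^sup>2" by (simp only: of_real_eq_iff)
      then have "c i = c j" using assms(4)[OF ij(1)] assms(4)[OF ij(2)] by simp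
      then show "i = j" using assms(3) ij by (auto dest: inj_onD)
    qed
    show "triple ?x ?x (c i *\<^sub>R e i) = complex_of_real ((c i)\<^sup>2) *\<^sub>C (c i *\<^sub>R e i)" if "i \<in> I" for i
      using box_orth_sum_eigen[OF assms(1,2) that, of "\<lambda>i. of_real (c i)"]
      by (simp add: scaleR_scaleC triple_scaleC_right mult.commute)
    show "?x \<in> odd_span ?x"
      unfolding odd_span_eq_orbit_span by (rule orbit_span_base)
  qed (use assms(1) in auto)
  then have "c i *\<^sub>R e i \<in> odd_span ?x" using assms(5) by blast
  then have "of_real (1 / c i) *\<^sub>C (c i *\<^sub>R e i) \<in> odd_span ?x" by (rule cvs.span_scale)
  then show ?thesis using assms(4)[OF assms(5)] by (simp add: scaleR_scaleC)
qed

text \<open>The number of spectral values is lower semicontinuous. The tripotents \<open>e i\<close> are linear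
combinations of odd powers of \<open>x0\<close>; the same combinations \<open>F i x\<close> of odd powers of a nearby
\<open>x\<close> stay close to \<open>e i\<close>, hence remain linearly independent. They lie in the span of the spectral
tripotents of \<open>x\<close>, so there are at least \<open>card I\<close> of those.\<close>

theorem open_set_of_large_spectrum:
  assumes I: "finite I" and e: "orth_family I e"
  obtains x0 \<delta> where "\<delta> > 0" "ball x0 \<delta> \<subseteq> ball 0 1"
    "\<And>S f. finite S \<Longrightarrow> orth_family S f \<Longrightarrow> (\<Sum>s\<in>S. s *\<^sub>R f s) \<in> ball x0 \<delta> \<Longrightarrow> card I \<le> card S"
proof -
  define n where "n = card I"
  obtain h where h: "bij_betw h I {0..<n}"
    using ex_bij_betw_finite_nat[OF I] n_def by blast
  \<comment> \<open>distinct coefficients in the open unit interval\<close>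
  define c where "c i = (real (h i) + 1) / (real n + 2)" for i
  have c: "inj_on c I" "\<And>i. i \<in> I \<Longrightarrow> 0 < c i" "\<And>i. i \<in> I \<Longrightarrow> c i \<le> (real n + 1) / (real n + 2)"
  proof -
    show "inj_on c I"
      using bij_betw_imp_inj_on[OF h] by (auto simp: inj_on_def c_def)
    show "0 < c i" if "i \<in> I" for i by (simp add: c_def)
    show "c i \<le> (real n + 1) / (real n + 2)" if "i \<in> I" for i
    proof -
      have "h i < n" using h that by (auto simp: bij_betw_def)
      then show ?thesis unfolding c_def by (intro divide_right_mono) auto
    qed
  qed
  define x0 where "x0 = (\<Sum>i\<in>I. c i *\<^sub>R e i)"
  have "norm x0 \<le> (real n + 1) / (real n + 2)"
    using norm_orth_sum_le[OF I e, of "\<lambda>i. of_real (c i)" "(real n + 1) / (real n + 2)"] c(2,3)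
    by (auto simp: x0_def scaleR_scaleC less_imp_le)
  then have x0: "norm x0 < 1" by (rule le_less_trans) simp
  have "\<exists>F. isCont F x0 \<and> F x0 = e i \<and> (\<forall>x. F x \<in> odd_span x)" if "i \<in> I" for i
    using odd_span_continuous_selection frame_in_odd_span[OF I e c(1,2) that] by (simp add: x0_def)
  then obtain F where F: "\<And>i. i \<in> I \<Longrightarrow> isCont (F i) x0" "\<And>i. i \<in> I \<Longrightarrow> F i x0 = e i"
    "\<And>i x. i \<in> I \<Longrightarrow> F i x \<in> odd_span x" by metis
  \<comment> \<open>so small that \<open>n\<close> errors of this size change a sum of norm \<open>m\<close> by less than \<open>m\<close>\<close>
  define \<eta> where "\<eta> = 1 / (2 * (real n + 1))"
  have "\<eta> > 0" by (simp add: \<eta>_def)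
  have "\<forall>\<^sub>F x in nhds x0. dist (F i x) (e i) < \<eta>" if "i \<in> I" for i
  proof -
    have "(F i \<longlongrightarrow> e i) (nhds x0)"
      using F(1,2)[OF that] by (simp add: isCont_def tendsto_nhds_iff)
    then show ?thesis using \<open>\<eta> > 0\<close> by (rule tendstoD)
  qed
  then have "\<forall>\<^sub>F x in nhds x0. \<forall>i\<in>I. dist (F i x) (e i) < \<eta>"
    using I by (simp add: eventually_ball_finite_distrib)
  then obtain d where d: "d > 0" "\<And>x i. dist x x0 < d \<Longrightarrow> i \<in> I \<Longrightarrow> dist (F i x) (e i) < \<eta>"
    unfolding eventually_nhds_metric by blast
  show ?thesis
  proof
    let ?\<delta> = "min d (1 - norm x0)"
    show "?\<delta> > 0" using d x0 by simp
    show "ball x0 ?\<delta> \<subseteq> ball 0 1"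
    proof
      fix x assume "x \<in> ball x0 ?\<delta>"
      then have "norm (x0 - x) < 1 - norm x0" by (simp add: dist_norm)
      then have "norm x < 1" using norm_triangle_sub[of x x0] by (simp add: norm_minus_commute)
      then show "x \<in> ball 0 1" by simp
    qed
    fix S f assume S: "finite S" "orth_family S f" and x: "(\<Sum>s\<in>S. s *\<^sub>R f s) \<in> ball x0 ?\<delta>"
    define x where "x = (\<Sum>s\<in>S. s *\<^sub>R f s)"
    have near: "norm (e i - F i x) \<le> \<eta>" if "i \<in> I" for i
      using d(2)[of x i] that x by (simp add: x_def dist_norm norm_minus_commute less_imp_le)
    have "card I \<le> card (f ` S)"
    proof (rule card_le_of_family_independent[OF I])
      show "F i x \<in> cvs.span (f ` S)" if "i \<in> I" for i
        using F(3)[OF that, of x] odd_span_subset_frame_span[OF S] by (auto simp: x_def)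
      fix q assume q: "(\<Sum>i\<in>I. q i *\<^sub>C F i x) = 0"
      show "\<forall>i\<in>I. q i = 0"
      proof (cases "I = {}")
        case False
        define m where "m = Max ((\<lambda>i. cmod (q i)) ` I)"
        have "m \<in> (\<lambda>i. cmod (q i)) ` I" unfolding m_def using False I by (intro Max_in) auto
        then obtain j where j: "j \<in> I" "m = cmod (q j)" by blast
        have le: "cmod (q i) \<le> m" if "i \<in> I" for i unfolding m_def using I that by (intro Max_ge) auto
        have "m \<le> norm (\<Sum>i\<in>I. q i *\<^sub>C e i)" using norm_orth_sum_ge[OF I e j(1)] j(2) by simp
        also have "(\<Sum>i\<in>I. q i *\<^sub>C e i) = (\<Sum>i\<in>I. q i *\<^sub>C (e i - F i x))"
          using q by (simp add: cvs.scale_right_diff_distrib sum_subtractf)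
        also have "norm \<dots> \<le> (\<Sum>i\<in>I. m * \<eta>)"
          using le near j by (intro sum_norm_le) (auto simp: norm_scaleC intro!: mult_mono)
        also have "\<dots> = real n * m * \<eta>" by (simp add: n_def)
        finally have "m \<le> m * (real n / (2 * (real n + 1)))" by (simp add: \<eta>_def mult_ac)
        moreover have "real n / (2 * (real n + 1)) < 1" by (simp add: field_simps)
        ultimately have "m \<le> 0"
          by (metis mult.right_neutral mult_less_cancel_left_pos not_le)
        then show ?thesis using le by (meson norm_le_zero_iff order_trans)
      qed simp
    qed (use S in auto)
    also have "\<dots> \<le> card S" using S(1) by (rule card_image_le)
    finally show "card I \<le> card S" .
  qed
qed

section \<open>Rank\<close>

lemma orth_family_inj_on:
  assumes "orth_family I e"
  shows "inj_on e I"
proof (rule inj_onI, rule ccontr)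
  fix i j assume "i \<in> I" "j \<in> I" "e i = e j" "i \<noteq> j"
  then show False
    using orth_familyD(1,2)[OF assms, of i] orth_familyD(4)[OF assms, of i j "e i"] by simp
qed

lemma orth_family_card_le_rank:
  assumes "finite I" "orth_family I e"
  shows "enat (card I) \<le> triple_rank triple"
proof -
  have "enat (card (e ` I)) \<le> triple_rank triple"
    unfolding triple_rank_def
    by (rule SUP_upper) (use assms in \<open>auto simp: orth_family_def pairwise_def\<close>)
  then show ?thesis by (simp add: card_image[OF orth_family_inj_on[OF assms(2)]])
qed

end

context finite_dim_jb_triple
begin

lemma odd_span_kernel:
  assumes "triple u u a = 0" "v \<in> odd_span a"
  shows "triple u u v = 0"
proof -
  have "odd_span a \<subseteq> {v. triple u u v = 0}"
  proof (rule odd_span_least)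
    show "cvs.subspace {v. triple u u v = 0}"
      by (auto simp: cvs.subspace_def triple_linear)
    show "triple a a y \<in> {v. triple u u v = 0}" if "y \<in> {v. triple u u v = 0}" for y
      using peirce_fusion[of u a 0 a 0 y 0] that assms(1) by simp
  qed (use assms(1) in simp)
  then show ?thesis using assms(2) by blast
qed

text \<open>Orthogonal non-zero tripotents are linearly independent, so the supremum that defines the rank
runs over bounded cardinalities.\<close>

lemma rank_attained:
  obtains E where "finite E" "orth_family E (\<lambda>e. e)" "triple_rank triple = enat (card E)"
proof -
  obtain B :: "'a set" where B: "finite B" "cvs.span B = UNIV"
    using finite_dim by (auto simp: complex_finite_dim_def)
  define \<E> where "\<E> = {E. finite E \<and> orth_family E (\<lambda>e. e)}"
  have bound: "card E \<le> card B" if "E \<in> \<E>" for E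
  proof (rule card_le_of_family_independent[where F = "\<lambda>e. e"])
    fix d assume "(\<Sum>a\<in>E. d a *\<^sub>C a) = 0"
    then show "\<forall>a\<in>E. d a = 0"
      using norm_orth_sum_ge[of E "\<lambda>e. e" _ d] that by (force simp: \<E>_def)
  qed (use that B in \<open>auto simp: \<E>_def\<close>)
  have "{} \<in> \<E>" by (simp add: \<E>_def orth_family_def)
  then have "\<exists>E. E \<in> \<E> \<and> (\<forall>E'. E' \<in> \<E> \<longrightarrow> card E' \<le> card E)"
    by (rule ex_has_greatest_nat[where b = "Suc (card B)"]) (simp add: bound less_Suc_eq_le)
  then obtain E where E: "E \<in> \<E>" "\<And>E'. E' \<in> \<E> \<Longrightarrow> card E' \<le> card E" by auto
  have "triple_rank triple \<le> enat (card E)"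
    unfolding triple_rank_def
    by (rule SUP_least) (use E(2) in \<open>auto simp: \<E>_def orth_family_def pairwise_def\<close>)
  moreover have "enat (card E) \<le> triple_rank triple"
    using E(1) orth_family_card_le_rank by (auto simp: \<E>_def)
  ultimately show ?thesis using that[of E] E(1) by (simp add: \<E>_def)
qed

text \<open>A non-zero element orthogonal to the whole family would have a spectral tripotent orthogonal to
the whole family, giving an orthogonal family that exceeds the rank.\<close>

lemma orth_family_maximal:
  assumes S: "finite S" "orth_family S u" and rank: "triple_rank triple \<le> enat (card S)"
    and a: "\<And>s. s \<in> S \<Longrightarrow> triple (u s) (u s) a = 0"
  shows "a = 0"
proof -
  obtain P f where P: "finite P" "orth_family P f" "\<And>p. p \<in> P \<Longrightarrow> f p \<in> odd_span a"
    "a = (\<Sum>p\<in>P. p *\<^sub>R f p)"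
    using spectral_decomposition[of a] by metis
  have "P = {}"
  proof (rule ccontr)
    assume "P \<noteq> {}"
    then obtain p where p: "p \<in> P" by blast
    note w = orth_familyD(2,3)[OF P(2) p]
    have orth: "triple (u s) (f p) z = 0" "triple (f p) (u s) z = 0" if "s \<in> S" for s z
      using tripotent_orthogonal[OF orth_familyD(3)[OF S(2) that]
          odd_span_kernel[OF a[OF that] P(3)[OF p]]] by blast+
    \<comment> \<open>the index \<open>None\<close> carries the additional tripotent\<close>
    have "orth_family (insert None (Some ` S)) (case_option (f p) u)"
      using S(2) w orth unfolding orth_family_def triple_orthogonal_def by auto
    then have "enat (card (insert None (Some ` S))) \<le> enat (card S)"
      using orth_family_card_le_rank[of "insert None (Some ` S)"] S(1) rank order_trans by blast
    then show False using S(1) by (simp add: card_image)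
  qed
  then show ?thesis using P(4) by simp
qed

end

section \<open>Linear isometries between triples of equal rank\<close>

locale jb_triple_isometry =
  V: finite_dim_jb_triple triple + W: finite_dim_jb_triple triple'
  for triple :: "'v::complex_banach \<Rightarrow> 'v \<Rightarrow> 'v \<Rightarrow> 'v"
    and triple' :: "'w::complex_banach \<Rightarrow> 'w \<Rightarrow> 'w \<Rightarrow> 'w" +
  fixes T :: "'v \<Rightarrow> 'w"
  assumes clinear_T: "clinear T" and norm_T: "norm (T x) = norm x"
begin

text \<open>An element of norm one has the spectral value \<open>1\<close>; its spectral tripotent is \<open>u\<close>, and the
rest \<open>b\<close> of the spectral decomposition is orthogonal to \<open>u\<close>.\<close>

lemma isometry_spectral_top:
  assumes "tripotent triple e" "e \<noteq> 0"
  obtains u b where "T e = u + b" "tripotent triple' u" "u \<noteq> 0" "triple' u u b = 0"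
    "u \<in> W.odd_span (T e)"
proof -
  obtain P f where P: "finite P" "\<And>p. p \<in> P \<Longrightarrow> p > 0" "W.orth_family P f"
    "\<And>p. p \<in> P \<Longrightarrow> f p \<in> W.odd_span (T e)" "T e = (\<Sum>p\<in>P. p *\<^sub>R f p)"
    using W.spectral_decomposition[of "T e"] by metis
  have nT: "norm (T e) = 1" using norm_T V.norm_tripotent[OF assms] by simp
  have le1: "p \<le> 1" if "p \<in> P" for p
    using W.spectral_value_le_norm[OF P(1,3) that P(2)[OF that]] nT P(5) by simp
  have "1 \<in> P"
  proof (rule ccontr)
    assume "1 \<notin> P"
    \<comment> \<open>the inserted \<open>0\<close> covers an empty spectrum\<close>
    define K where "K = Max (insert 0 P)"
    have "K \<in> insert 0 P" unfolding K_def using P(1) by (intro Max_in) auto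
    then have "K < 1" using le1 \<open>1 \<notin> P\<close> by (metis insertE less_eq_real_def zero_less_one)
    have "norm (\<Sum>p\<in>P. of_real p *\<^sub>C f p) \<le> K"
    proof (rule W.norm_orth_sum_le[OF P(1,3)])
      show "cmod (of_real p) \<le> K" if "p \<in> P" for p
        using P(1) P(2)[OF that] that by (simp add: K_def)
      show "0 \<le> K" using P(1) by (simp add: K_def)
    qed
    then show False using nT P(5) \<open>K < 1\<close> by (simp add: scaleR_scaleC)
  qed
  let ?b = "\<Sum>p\<in>P - {1}. p *\<^sub>R f p"
  have "T e = f 1 + ?b" using P(1,5) \<open>1 \<in> P\<close> by (simp add: sum.remove[of P 1])
  moreover have "triple' (f 1) (f 1) ?b = 0"
    using W.orth_family_box[OF P(3) \<open>1 \<in> P\<close>]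
    by (auto simp: W.triple_sum_right W.triple_scaleR intro!: sum.neutral)
  ultimately show ?thesis
    using that W.orth_familyD(2,3)[OF P(3) \<open>1 \<in> P\<close>] P(4)[OF \<open>1 \<in> P\<close>] by blast
qed

context
  fixes S :: "'i set" and e :: "'i \<Rightarrow> 'v"
  assumes S: "finite S" and e: "V.orth_family S e" and rank: "triple_rank triple' \<le> enat (card S)"
begin

text \<open>Write \<open>T (e s) = u s + b s\<close> as in \<open>isometry_spectral_top\<close>. For \<open>s \<noteq> t\<close> the disc
\<open>T (e s) + \<mu> T (e t)\<close> lies in the unit ball, so \<open>T (e t)\<close> and with it \<open>u t\<close> and \<open>b t\<close> are orthogonal to
\<open>u s\<close>. Thus the \<open>u s\<close> form an orthogonal family that attains the rank of the target, and \<open>b t\<close>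
is orthogonal to all of it, hence zero. This is the place where the equality of the ranks enters.\<close>

lemma isometry_preserves_frame: "W.orth_family S (\<lambda>s. T (e s))"
proof -
  have "\<forall>s\<in>S. \<exists>u b. T (e s) = u + b \<and> tripotent triple' u \<and> u \<noteq> 0 \<and> triple' u u b = 0
      \<and> u \<in> W.odd_span (T (e s))"
    using isometry_spectral_top V.orth_familyD(2,3)[OF e] by metis
  then obtain u b where u: "\<And>s. s \<in> S \<Longrightarrow> T (e s) = u s + b s"
      "\<And>s. s \<in> S \<Longrightarrow> tripotent triple' (u s)" "\<And>s. s \<in> S \<Longrightarrow> u s \<noteq> 0"
      "\<And>s. s \<in> S \<Longrightarrow> triple' (u s) (u s) (b s) = 0" "\<And>s. s \<in> S \<Longrightarrow> u s \<in> W.odd_span (T (e s))"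
    by metis
  have ker: "triple' (u s) (u s) (T (e t)) = 0" if st: "s \<in> S" "t \<in> S" "s \<noteq> t" for s t
  proof (rule W.disc_around_tripotent_orthogonal[OF u(2)[OF st(1)] u(4)[OF st(1)]])
    fix \<mu> :: complex assume "cmod \<mu> = 1"
    have "norm (\<Sum>i\<in>{s, t}. (if i = s then 1 else \<mu>) *\<^sub>C e i) \<le> 1"
      using \<open>cmod \<mu> = 1\<close> st by (intro V.norm_orth_sum_le_1 V.orth_family_subset[OF e]) auto
    then have "norm (T (e s + \<mu> *\<^sub>C e t)) \<le> 1" using st(3) by (simp add: norm_T)
    then show "norm (u s + b s + \<mu> *\<^sub>C T (e t)) \<le> 1"
      using u(1)[OF st(1)] by (simp add: clinear_simps[OF clinear_T])
  qed
  have ker_u: "triple' (u s) (u s) (u t) = 0" if "s \<in> S" "t \<in> S" "s \<noteq> t" for s t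
    using W.odd_span_kernel[OF ker[OF that] u(5)[OF that(2)]] .
  have fam: "W.orth_family S u"
    unfolding W.orth_family_def triple_orthogonal_def
    using u(2,3) W.tripotent_orthogonal(1)[OF u(2) ker_u] by blast
  have "T (e t) = u t" if t: "t \<in> S" for t
  proof -
    have "b t = 0"
    proof (rule W.orth_family_maximal[OF S fam rank])
      fix s assume s: "s \<in> S"
      show "triple' (u s) (u s) (b t) = 0"
      proof (cases "s = t")
        case True
        then show ?thesis using u(4)[OF t] by simp
      next
        case False
        then have "triple' (u s) (u s) (u t + b t) = 0" using ker[OF s t] u(1)[OF t] by simp
        then show ?thesis using ker_u[OF s t False] by (simp add: W.triple_add_right)
      qed
    qed
    then show ?thesis using u(1)[OF t] by simp
  qed
  then show ?thesis using fam by (simp add: W.orth_family_def cong: ball_cong)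
qed

text \<open>The images \<open>T (e s)\<close> form an orthogonal family that attains the rank. The direction of a disc
around their sum is orthogonal to each of them, hence zero.\<close>

lemma frame_sum_extreme:
  assumes "\<And>\<mu>. cmod \<mu> = 1 \<Longrightarrow> norm (T (\<Sum>s\<in>S. e s) + \<mu> *\<^sub>C a) \<le> 1"
  shows "a = 0"
proof (rule W.orth_family_maximal[OF S isometry_preserves_frame rank])
  fix s assume s: "s \<in> S"
  note fam = isometry_preserves_frame
  show "triple' (T (e s)) (T (e s)) a = 0"
  proof (rule W.disc_around_tripotent_orthogonal[OF W.orth_familyD(3)[OF fam s]])
    show "triple' (T (e s)) (T (e s)) (\<Sum>t\<in>S - {s}. T (e t)) = 0"
      using W.orth_family_box[OF fam s] by (auto simp: W.triple_sum_right intro!: sum.neutral split: if_splits)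
    have "T (\<Sum>s\<in>S. e s) = T (e s) + (\<Sum>t\<in>S - {s}. T (e t))"
      using S s by (simp add: clinear_simps[OF clinear_T] sum.remove[of S s])
    then show "norm (T (e s) + (\<Sum>t\<in>S - {s}. T (e t)) + \<mu> *\<^sub>C a) \<le> 1" if "cmod \<mu> = 1" for \<mu>
      using assms[OF that] by simp
  qed
qed

lemma isometry_cube_on_frame:
  fixes c :: "'i \<Rightarrow> complex"
  defines "x \<equiv> \<Sum>s\<in>S. c s *\<^sub>C e s"
  shows "T (triple x x x) = triple' (T x) (T x) (T x)"
proof -
  have "T x = (\<Sum>s\<in>S. c s *\<^sub>C T (e s))" by (simp add: x_def clinear_simps[OF clinear_T])
  then have "triple' (T x) (T x) (T x) = (\<Sum>i\<in>S. (cmod (c i))\<^sup>2 *\<^sub>R (c i *\<^sub>C T (e i)))"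
    using W.cube_orth_sum[OF S isometry_preserves_frame] by simp
  also have "\<dots> = T (triple x x x)"
    unfolding x_def V.cube_orth_sum[OF S e]
    by (simp add: clinear_simps[OF clinear_T] scaleR_scaleC)
  finally show ?thesis by simp
qed

end

lemma triple_hom_of_cube:
  assumes cube: "\<And>x. T (triple x x x) = triple' (T x) (T x) (T x)"
  shows "triple_hom triple triple' T"
proof -
  note lin = clinear_simps[OF clinear_T]
  have TR: "T (r *\<^sub>R x) = r *\<^sub>R T x" for r x by (simp add: scaleR_scaleC lin)
  have box: "T (triple z z x) = triple' (T z) (T z) (T x)" for z x
  proof -
    have "T (4 *\<^sub>R triple x x x + 4 *\<^sub>R (2 *\<^sub>R triple z z x))
        = 4 *\<^sub>R triple' (T x) (T x) (T x) + 4 *\<^sub>R (2 *\<^sub>R triple' (T z) (T z) (T x))"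
      unfolding V.cube_polarization[symmetric] W.cube_polarization[symmetric]
      by (simp only: lin cube)
    then show ?thesis by (simp add: lin TR cube)
  qed
  have "T (triple x y z) = triple' (T x) (T y) (T z)" for x y z
  proof -
    have "T (4 *\<^sub>R triple x y z) = 4 *\<^sub>R triple' (T x) (T y) (T z)"
      unfolding V.triple_polarization W.triple_polarization by (simp only: lin box)
    then show ?thesis by (simp add: TR)
  qed
  then show ?thesis using clinear_T by (simp add: triple_hom_def)
qed

text \<open>On a line \<open>x0 + t y\<close> the defect \<open>T (x\<^sup>3) - (T x)\<^sup>3\<close> is a cubic polynomial \<open>A + t B + t\<^sup>2 C + t\<^sup>3 D\<close> in the
real variable \<open>t\<close>, with the defect at \<open>y\<close> as leading coefficient. It vanishes for small \<open>t\<close>, and the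
four points \<open>0, h, - h, 2 h\<close> suffice to conclude \<open>D = 0\<close>.\<close>

lemma triple_hom_of_cube_on_ball:
  assumes "\<delta> > 0" and cube: "\<And>x. x \<in> ball x0 \<delta> \<Longrightarrow> T (triple x x x) = triple' (T x) (T x) (T x)"
  shows "triple_hom triple triple' T"
proof (rule triple_hom_of_cube)
  fix y
  note lin = clinear_simps[OF clinear_T]
  have TR: "T (r *\<^sub>R x) = r *\<^sub>R T x" for r x by (simp add: scaleR_scaleC lin)
  define A where "A = T (triple x0 x0 x0) - triple' (T x0) (T x0) (T x0)"
  define B where "B = T (triple y x0 x0 + triple x0 y x0 + triple x0 x0 y)
    - (triple' (T y) (T x0) (T x0) + triple' (T x0) (T y) (T x0) + triple' (T x0) (T x0) (T y))"
  define C where "C = T (triple y y x0 + triple y x0 y + triple x0 y y)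
    - (triple' (T y) (T y) (T x0) + triple' (T y) (T x0) (T y) + triple' (T x0) (T y) (T y))"
  define D where "D = T (triple y y y) - triple' (T y) (T y) (T y)"
  have G: "A + t *\<^sub>R B + t\<^sup>2 *\<^sub>R C + t ^ 3 *\<^sub>R D = 0" if "\<bar>t\<bar> * norm y < \<delta>" for t :: real
  proof -
    have "x0 + t *\<^sub>R y \<in> ball x0 \<delta>" using that by (simp add: dist_norm)
    from cube[OF this] have "T (triple (x0 + t *\<^sub>R y) (x0 + t *\<^sub>R y) (x0 + t *\<^sub>R y))
      = triple' (T x0 + t *\<^sub>R T y) (T x0 + t *\<^sub>R T y) (T x0 + t *\<^sub>R T y)"
      by (simp add: lin TR)
    then show ?thesis
      unfolding V.cube_line W.cube_line A_def B_def C_def D_def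
      by (simp add: lin TR scaleR_diff_right algebra_simps)
  qed
  define a where "a = 2 * norm y + 1"
  have a: "a > 0" "norm y < a" by (simp_all add: a_def add_nonneg_pos add_strict_increasing)
  define h where "h = \<delta> / (2 * a)"
  have "h > 0" using \<open>\<delta> > 0\<close> a by (simp add: h_def)
  have hy: "2 * h * norm y < \<delta>"
  proof -
    have "2 * h * norm y = \<delta> * (norm y / a)" by (simp add: h_def)
    also have "\<dots> < \<delta> * 1"
      using \<open>\<delta> > 0\<close> a by (intro mult_strict_left_mono) auto
    finally show ?thesis by simp
  qed
  define B' C' D' where "B' = h *\<^sub>R B" and "C' = h\<^sup>2 *\<^sub>R C" and "D' = h ^ 3 *\<^sub>R D"
  have "0 \<le> h * norm y" using \<open>h > 0\<close> by simp
  then have hy1: "h * norm y < \<delta>" using hy unfolding mult.assoc by linarith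
  have "A = 0" using G[of 0] \<open>\<delta> > 0\<close> by simp
  then have 1: "B' + C' + D' = 0" and 2: "- B' + C' - D' = 0" and 3: "2 *\<^sub>R B' + 4 *\<^sub>R C' + 8 *\<^sub>R D' = 0"
    using G[of h] G[of "- h"] G[of "2 * h"] hy hy1 \<open>h > 0\<close>
    by (simp_all add: B'_def C'_def D'_def power2_eq_square power3_eq_cube mult.assoc)
  have "2 *\<^sub>R C' = (B' + C' + D') + (- B' + C' - D')" by (simp add: scaleR_2)
  then have C0: "C' = 0" using 1 2 by simp
  then have "B' = - D'" using 1 by (simp add: eq_neg_iff_add_eq_0)
  then have "8 *\<^sub>R D' - 2 *\<^sub>R D' = 0" using 3 C0 by simp
  then have "D' = 0" by (simp flip: scaleR_left_diff_distrib)
  then have "D = 0" using \<open>h > 0\<close> by (simp add: D'_def)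
  then show "T (triple y y y) = triple' (T y) (T y) (T y)" by (simp add: D_def)
qed

section \<open>Holomorphic maps tangent to an isometry\<close>

text \<open>On the torus where all coefficients have modulus \<open>\<rho>\<close>, the argument is \<open>\<rho>\<close> times the sum of a rotated
frame, and the Schwarz lemma at an extreme point applies. The maximum principle, used in one
coordinate after the other, extends the equality to the polydisc; \<open>J\<close> is the set of coordinates
that have already been released from the torus.\<close>

lemma holomorphic_eq_isometry_on_frame:
  assumes S: "finite S" and e: "V.orth_family S e" and rank: "triple_rank triple' \<le> enat (card S)"
    and hol: "holomorphic_map \<phi> (ball 0 1)" and le: "\<And>x. norm x < 1 \<Longrightarrow> norm (\<phi> x) \<le> norm x"
    and T: "bounded_clinear T" "(\<phi> has_derivative T) (at 0)"
    and c: "\<And>s. s \<in> S \<Longrightarrow> cmod (c s) \<le> \<rho>" and \<rho>: "0 < \<rho>" "\<rho> < 1"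
  shows "\<phi> (\<Sum>s\<in>S. c s *\<^sub>C e s) = T (\<Sum>s\<in>S. c s *\<^sub>C e s)"
proof -
  have torus: "\<phi> (\<Sum>s\<in>S. c s *\<^sub>C e s) = T (\<Sum>s\<in>S. c s *\<^sub>C e s)"
    if c: "\<And>s. s \<in> S \<Longrightarrow> cmod (c s) = \<rho>" for c
  proof -
    define \<theta> where "\<theta> s = c s / of_real \<rho>" for s
    have \<theta>: "cmod (\<theta> s) = 1" if "s \<in> S" for s using c[OF that] \<rho> by (simp add: \<theta>_def norm_divide)
    note fam = V.orth_family_rotate[OF e \<theta>]
    let ?e = "\<Sum>s\<in>S. \<theta> s *\<^sub>C e s"
    have "norm ?e \<le> 1" using V.norm_orth_sum_le_1[OF S e] \<theta> by simp
    then have "\<phi> (of_real \<rho> *\<^sub>C ?e) = of_real \<rho> *\<^sub>C T ?e"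
      using schwarz_equality_at_extreme_point[OF W.finite_dim hol le T, of ?e "of_real \<rho>"]
        frame_sum_extreme[OF S fam rank] \<rho> by (simp add: norm_T)
    moreover have "of_real \<rho> *\<^sub>C ?e = (\<Sum>s\<in>S. c s *\<^sub>C e s)"
      using \<rho> by (simp add: cvs.scale_sum_right \<theta>_def)
    ultimately show ?thesis using clinear_scaleC[OF clinear_T, of "of_real \<rho>" ?e] by simp
  qed
  have "\<phi> (\<Sum>s\<in>S. c s *\<^sub>C e s) = T (\<Sum>s\<in>S. c s *\<^sub>C e s)"
    if "finite J" "J \<subseteq> S" "\<And>s. s \<in> S \<Longrightarrow> cmod (c s) \<le> \<rho>" "\<And>s. s \<in> S - J \<Longrightarrow> cmod (c s) = \<rho>" for J c
    using that
  proof (induction J arbitrary: c rule: finite_induct)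
    case empty
    then show ?case using torus by simp
  next
    case (insert k J)
    have k: "k \<in> S" "k \<notin> J" using insert by auto
    define v where "v = (\<Sum>s\<in>S - {k}. c s *\<^sub>C e s)"
    have split: "(\<Sum>s\<in>S. (c(k := \<zeta>)) s *\<^sub>C e s) = v + \<zeta> *\<^sub>C e k" for \<zeta>
    proof -
      have "(\<Sum>s\<in>S. (c(k := \<zeta>)) s *\<^sub>C e s) = \<zeta> *\<^sub>C e k + (\<Sum>s\<in>S - {k}. (c(k := \<zeta>)) s *\<^sub>C e s)"
        using S k(1) by (subst sum.remove[of S k]) auto
      also have "(\<Sum>s\<in>S - {k}. (c(k := \<zeta>)) s *\<^sub>C e s) = v"
        unfolding v_def by (intro sum.cong) auto
      finally show ?thesis by (simp add: add.commute)
    qed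
    have inball: "norm (v + \<zeta> *\<^sub>C e k) < 1" if "cmod \<zeta> < 1" for \<zeta>
    proof -
      have "norm (v + \<zeta> *\<^sub>C e k) \<le> max \<rho> (cmod \<zeta>)"
        unfolding split[symmetric] using insert.prems(2) \<rho>
        by (intro V.norm_orth_sum_le[OF S e]) (auto simp: max.coboundedI1)
      then show ?thesis using that \<rho> by simp
    qed
    have "\<phi> (v + c k *\<^sub>C e k) = T (v + c k *\<^sub>C e k)"
    proof (rule eq_by_functionals[OF W.finite_dim])
      fix \<psi> :: "'w \<Rightarrow> complex" assume \<psi>: "bounded_clinear \<psi>"
      define F where "F \<zeta> = \<psi> (\<phi> (v + \<zeta> *\<^sub>C e k)) - (\<psi> (T v) + \<zeta> * \<psi> (T (e k)))" for \<zeta>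
      have psiT: "\<psi> (T (v + \<zeta> *\<^sub>C e k)) = \<psi> (T v) + \<zeta> * \<psi> (T (e k))" for \<zeta>
        by (simp add: clinear_simps[OF clinear_T] clinear_simps[OF bounded_clinear_imp_clinear[OF \<psi>]]
            scaleC_complex_def)
      have "F holomorphic_on ball 0 1"
        unfolding F_def by (intro holomorphic_intros holomorphic_on_line[OF hol \<psi>]) (simp add: inball)
      then have hF: "F holomorphic_on cball 0 \<rho>"
        by (rule holomorphic_on_subset) (use \<rho> in auto)
      have "cmod (F (c k)) \<le> 0"
      proof (rule maximum_modulus_frontier[of F "cball 0 \<rho>"])
        show "F holomorphic_on interior (cball 0 \<rho>)"
          by (rule holomorphic_on_subset[OF hF interior_subset])
        show "continuous_on (closure (cball 0 \<rho>)) F"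
          using holomorphic_on_imp_continuous_on[OF hF] by simp
        show "cmod (F z) \<le> 0" if "z \<in> frontier (cball 0 \<rho>)" for z
        proof -
          have z: "cmod z = \<rho>" using that \<rho> by (simp add: frontier_cball)
          have "\<phi> (\<Sum>s\<in>S. (c(k := z)) s *\<^sub>C e s) = T (\<Sum>s\<in>S. (c(k := z)) s *\<^sub>C e s)"
            using insert.prems z by (intro insert.IH) auto
          then show ?thesis unfolding split by (simp add: F_def psiT)
        qed
      qed (use insert.prems(2) k in auto)
      then show "\<psi> (\<phi> (v + c k *\<^sub>C e k)) = \<psi> (T (v + c k *\<^sub>C e k))" by (simp add: F_def psiT)
    qed
    then show ?case using split[of "c k"] by simp
  qed
  from this[of S c] show ?thesis using S c by simp
qed

text \<open>The identity theorem on the intersection of the unit ball with the complex line through \<open>x0\<close> and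
\<open>y\<close>, a convex domain in which the line parameter of \<open>x0\<close> is \<open>0\<close> and that of \<open>y\<close> is \<open>1\<close>.\<close>

lemma holomorphic_eq_isometry_on_ball:
  assumes hol: "holomorphic_map \<phi> (ball 0 1)" and "\<delta> > 0" and sub: "ball x0 \<delta> \<subseteq> ball 0 1"
    and eq: "\<And>x. x \<in> ball x0 \<delta> \<Longrightarrow> \<phi> x = T x" and y: "norm y < 1"
  shows "\<phi> y = T y"
proof (rule eq_by_functionals[OF W.finite_dim])
  fix \<psi> :: "'w \<Rightarrow> complex" assume \<psi>: "bounded_clinear \<psi>"
  define d where "d = y - x0"
  define L where "L = {\<zeta>. norm (x0 + \<zeta> *\<^sub>C d) < 1}"
  define U where "U = {\<zeta>. norm (\<zeta> *\<^sub>C d) < \<delta>}"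
  define F where "F \<zeta> = \<psi> (\<phi> (x0 + \<zeta> *\<^sub>C d)) - (\<psi> (T x0) + \<zeta> * \<psi> (T d))" for \<zeta>
  have psiT: "\<psi> (T (x0 + \<zeta> *\<^sub>C d)) = \<psi> (T x0) + \<zeta> * \<psi> (T d)" for \<zeta>
    by (simp add: clinear_simps[OF clinear_T] clinear_simps[OF bounded_clinear_imp_clinear[OF \<psi>]]
        scaleC_complex_def)
  have cont: "continuous_on UNIV (\<lambda>\<zeta>. \<zeta> *\<^sub>C d)"
    by (rule linear_continuous_on[OF bounded_linear_scaleC_left])
  have openL: "open L" unfolding L_def by (intro open_Collect_less continuous_intros cont)
  have openU: "open U" unfolding U_def by (intro open_Collect_less continuous_intros cont)
  have "convex L"
  proof (rule convexI)
    fix a b :: complex and p q :: real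
    assume ab: "a \<in> L" "b \<in> L" and pq: "0 \<le> p" "0 \<le> q" "p + q = 1"
    have "x0 + (p *\<^sub>R a + q *\<^sub>R b) *\<^sub>C d = p *\<^sub>R (x0 + a *\<^sub>C d) + q *\<^sub>R (x0 + b *\<^sub>C d)"
    proof -
      have "p *\<^sub>R x0 + q *\<^sub>R x0 = x0" using pq(3) by (simp flip: scaleR_left_distrib)
      then show ?thesis
        by (simp add: scaleC_add_right scaleC_add_left scaleR_scaleC scaleC_complex_def algebra_simps)
    qed
    moreover have "convex (ball (0::'v) 1)" by (rule convex_ball)
    then have "p *\<^sub>R (x0 + a *\<^sub>C d) + q *\<^sub>R (x0 + b *\<^sub>C d) \<in> ball 0 1"
      using ab pq by (intro convexD) (auto simp: L_def)
    ultimately show "p *\<^sub>R a + q *\<^sub>R b \<in> L" by (simp add: L_def)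
  qed
  have UL: "\<zeta> \<in> L \<and> F \<zeta> = 0" if "\<zeta> \<in> U" for \<zeta>
  proof -
    have mem: "x0 + \<zeta> *\<^sub>C d \<in> ball x0 \<delta>" using that by (simp add: U_def dist_norm)
    then show ?thesis using sub eq[OF mem] by (auto simp: L_def F_def psiT)
  qed
  have "F 1 = 0"
  proof (rule analytic_continuation[of F L U 0])
    show "F holomorphic_on L"
      unfolding F_def by (intro holomorphic_intros holomorphic_on_line[OF hol \<psi>]) (simp add: L_def)
    have "0 \<in> U" using \<open>\<delta> > 0\<close> by (simp add: U_def)
    then show "0 \<in> L" using UL by blast
    show "0 islimpt U" using \<open>0 \<in> U\<close> openU interior_limit_point interior_open by blast
    show "1 \<in> L" using y by (simp add: L_def d_def)
  qed (use openL convex_connected[OF \<open>convex L\<close>] UL in auto)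
  then show "\<psi> (\<phi> y) = \<psi> (T y)" using psiT[of 1] by (simp add: F_def d_def)
qed

end

lemma caratheodory_isometry_norm:
  fixes \<phi> :: "'v::complex_normed_vector \<Rightarrow> 'w::complex_normed_vector"
  assumes fd: "complex_finite_dim TYPE('v)" "complex_finite_dim TYPE('w)"
    and ball: "\<phi> ` ball 0 1 \<subseteq> ball 0 1" "\<phi> 0 = 0"
    and dist: "\<forall>x\<in>ball 0 1. \<forall>y\<in>ball 0 1.
      caratheodory_dist (ball 0 1) (\<phi> x) (\<phi> y) = caratheodory_dist (ball 0 1) x y"
    and x: "norm x < 1"
  shows "norm (\<phi> x) = norm x"
proof -
  have fx: "norm (\<phi> x) < 1" using ball(1) x by (auto simp: image_subset_iff)
  have "caratheodory_dist (ball 0 1) (\<phi> 0) (\<phi> x) = caratheodory_dist (ball 0 1) 0 x"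
    using dist x by simp
  then have "artanh (norm (\<phi> x)) = artanh (norm x)"
    using caratheodory_dist_centre[OF fd(1) x] caratheodory_dist_centre[OF fd(2) fx] ball(2) by simp
  then show ?thesis
    using artanh_real_less[of "norm x" "norm (\<phi> x)"] artanh_real_less[of "norm (\<phi> x)" "norm x"] x fx
    by (metis less_irrefl linorder_neqE norm_ge_zero)
qed

lemma derivative_isometry:
  fixes \<phi> :: "'v::complex_normed_vector \<Rightarrow> 'w::complex_normed_vector"
  assumes T: "bounded_clinear T" "(\<phi> has_derivative T) (at 0)" and "\<phi> 0 = 0"
    and norm: "\<And>x. norm x < 1 \<Longrightarrow> norm (\<phi> x) = norm x"
  shows "norm (T x) = norm x"
proof -
  have "((\<lambda>t. t *\<^sub>R x) has_derivative (\<lambda>t. t *\<^sub>R x)) (at 0)"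
    by (rule bounded_linear_imp_has_derivative[OF bounded_linear_scaleR_left])
  then have "((\<lambda>t::real. \<phi> (t *\<^sub>R x)) has_derivative (\<lambda>t. T (t *\<^sub>R x))) (at 0)"
    by (rule has_derivative_compose) (use T(2) in simp)
  moreover have "T (t *\<^sub>R x) = t *\<^sub>R T x" for t
    by (simp add: scaleR_scaleC clinear_scaleC[OF bounded_clinear_imp_clinear[OF T(1)]])
  ultimately have "((\<lambda>t::real. norm (\<phi> (t *\<^sub>R x) - t *\<^sub>R T x) / norm t) \<longlongrightarrow> 0) (at 0)"
    using \<open>\<phi> 0 = 0\<close> by (simp add: has_derivative_at)
  moreover have "\<forall>\<^sub>F t in at 0. \<bar>norm x - norm (T x)\<bar> \<le> norm (\<phi> (t *\<^sub>R x) - t *\<^sub>R T x) / norm t"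
  proof -
    have "((\<lambda>t::real. norm (t *\<^sub>R x)) \<longlongrightarrow> norm (0 *\<^sub>R x)) (at 0)" by (intro tendsto_intros)
    then have "\<forall>\<^sub>F t in at (0::real). norm (t *\<^sub>R x) < 1"
      by (rule order_tendstoD(2)) simp
    moreover have "\<forall>\<^sub>F t in at (0::real). t \<noteq> 0" by (simp add: eventually_at_filter)
    ultimately show ?thesis
    proof eventually_elim
      case (elim t)
      have "\<bar>t\<bar> * \<bar>norm x - norm (T x)\<bar> = \<bar>norm (\<phi> (t *\<^sub>R x)) - norm (t *\<^sub>R T x)\<bar>"
        using norm[OF elim(1)] by (simp add: right_diff_distrib flip: abs_mult)
      also have "\<dots> \<le> norm (\<phi> (t *\<^sub>R x) - t *\<^sub>R T x)" by (rule norm_triangle_ineq3)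
      finally show ?case using elim(2) by (simp add: pos_le_divide_eq mult.commute)
    qed
  qed
  ultimately have "\<bar>norm x - norm (T x)\<bar> \<le> 0"
    by (rule tendsto_lowerbound) simp
  then show ?thesis by simp
qed

section \<open>Holomorphic Caratheodory isometries are triple homomorphisms\<close>

theorem theorem1p5:
  fixes triple :: "'v::complex_banach \<Rightarrow> 'v \<Rightarrow> 'v \<Rightarrow> 'v"
    and triple' :: "'w::complex_banach \<Rightarrow> 'w \<Rightarrow> 'w \<Rightarrow> 'w"
    and \<phi> :: "'v \<Rightarrow> 'w"
  assumes "jb_triple triple" and "complex_finite_dim TYPE('v)"
    and "jb_triple triple'" and "complex_finite_dim TYPE('w)"
    and "triple_rank triple = triple_rank triple'"
    and "\<phi> ` ball 0 1 \<subseteq> ball 0 1"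
    and "\<forall>x\<in>ball 0 1. \<forall>y\<in>ball 0 1.
      caratheodory_dist (ball 0 1) (\<phi> x) (\<phi> y) = caratheodory_dist (ball 0 1) x y"
    and "holomorphic_map \<phi> (ball 0 1)"
    and "\<phi> 0 = 0"
  shows "\<exists>T. triple_hom triple triple' T \<and> (\<forall>z\<in>ball 0 1. \<phi> z = T z)"
proof -
  have norm: "norm (\<phi> x) = norm x" if "norm x < 1" for x
    by (rule caratheodory_isometry_norm[OF assms(2,4,6,9,7) that])
  obtain T where T: "bounded_clinear T" "(\<phi> has_derivative T) (at 0)"
    by (rule holomorphic_map_ballD[OF assms(8), of 0]) auto
  interpret jb_triple_isometry triple triple' T
    by (intro jb_triple_isometry.intro finite_dim_jb_triple.intro finite_dim_jb_triple_axioms.intro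
        jb_triple_isometry_axioms.intro assms bounded_clinear_imp_clinear[OF T(1)]
        derivative_isometry[OF T assms(9) norm])
  obtain E where E: "finite E" "V.orth_family E (\<lambda>e. e)" "triple_rank triple = enat (card E)"
    by (rule V.rank_attained)
  obtain x0 \<delta> where \<delta>: "\<delta> > 0" "ball x0 \<delta> \<subseteq> ball 0 1"
    and large: "\<And>(S :: real set) f. finite S \<Longrightarrow> V.orth_family S f \<Longrightarrow>
      (\<Sum>s\<in>S. s *\<^sub>R f s) \<in> ball x0 \<delta> \<Longrightarrow> card E \<le> card S"
    by (rule V.open_set_of_large_spectrum[OF E(1,2)]) (rule that)
  have local: "T (triple x x x) = triple' (T x) (T x) (T x) \<and> \<phi> x = T x" if x: "x \<in> ball x0 \<delta>" for x
  proof -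
    obtain S f where S: "finite S" "\<And>s. s \<in> S \<Longrightarrow> s > 0" "V.orth_family S f" "x = (\<Sum>s\<in>S. s *\<^sub>R f s)"
      using V.spectral_decomposition[of x] by metis
    then have "card E \<le> card S" using large x by simp
    then have rank: "triple_rank triple' \<le> enat (card S)"
      unfolding assms(5)[symmetric] E(3) by simp
    have xC: "x = (\<Sum>s\<in>S. of_real s *\<^sub>C f s)" using S(4) by (simp add: scaleR_scaleC)
    have x1: "norm x < 1" using \<delta>(2) x by auto
    have "s \<le> norm x" if "s \<in> S" for s
      using V.spectral_value_le_norm[OF S(1,3) that S(2)[OF that]] S(4) by simp
    then have le: "cmod (of_real s) \<le> (1 + norm x) / 2" if "s \<in> S" for s
      using S(2)[OF that] that x1 by fastforce
    have "\<phi> x = T x"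
      unfolding xC
      by (rule holomorphic_eq_isometry_on_frame[OF S(1,3) rank assms(8) _ T, where \<rho> = "(1 + norm x) / 2"])
         (use le norm x1 in \<open>auto simp: add_pos_nonneg\<close>)
    moreover have "T (triple x x x) = triple' (T x) (T x) (T x)"
      unfolding xC by (rule isometry_cube_on_frame[OF S(1,3) rank])
    ultimately show ?thesis by blast
  qed
  have "triple_hom triple triple' T"
    using triple_hom_of_cube_on_ball[OF \<delta>(1)] local by blast
  moreover have "\<phi> z = T z" if "z \<in> ball 0 1" for z
    using holomorphic_eq_isometry_on_ball[OF assms(8) \<delta>] local that by auto
  ultimately show ?thesis by blast
qed

end
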